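(* Let $r\geqslant 3$ be a fixed integer, let $\alpha>\frac12$ be a constant, and suppose $p=p(n)$ satisfies $p=o\bigl(n^{-\frac12}(\log n)^{\alpha(3-r)}\bigr)$ and $p=\omega(n^{-2})$. Then with high probability the final number of edges added in the random $r$-generalized triadic process on $[n]$ driven by $\mathbb{H}_r(n,p)$ equals $\frac12 n^2 p(1\pm o(1))$.
   Context: For a fixed integer $r\geqslant 3$, $\mathbb{H}_r(n,p)$ is the random $r$-uniform hypergraph on vertex set $[n]=\{1,\dots,n\}$ in which each $r$-subset of $[n]$ is a hyperedge independently with probability $p$. The random $r$-generalized triadic process starts with the complete bipartite graph $K_{r-2,n-r+2}$ on $[n]$, whose one part is a fixed set $\{v_1,\dots,v_{r-2}\}$ and whose other part is $[n]\setminus\{v_1,\dots,v_{r-2}\}$. It repeatedly chooses two distinct vertices $x,y$ uniformly at random and adds $\{x,y\}$ as an edge of the current graph if there is a set $Z=\{z_1,\dots,z_{r-2}\}\subseteq[n]\setminus\{x,y\}$ of size $r-2$ such that $\{x,z_i\}$ and $\{y,z_i\}$ are edges of the current graph for all $1\leqslant i\leqslant r-2$ and $\{x,y,z_1,\dots,z_{r-2}\}$ is a hyperedge of $\mathbb{H}_r(n,p)$; it continues until no further pair can be added. The final number of added edges is the number of edges of the final graph not belonging to the initial $K_{r-2,n-r+2}$. Asymptotics are as $n\to\infty$; "with high probability" means with probability tending to $1$; $\log$ is the natural logarithm. *)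

theory Defs
  imports "HOL-Probability.Probability" "HOL-Library.Landau_Symbols"
begin

text \<open>Graphs and hypergraphs are represented by their sets of (hyper)edges; the vertex set is
  always \<open>{1..n}\<close>.\<close>

definition random_hypergraph :: "nat \<Rightarrow> nat \<Rightarrow> real \<Rightarrow> nat set set pmf" where
  "random_hypergraph r n p =
     map_pmf Collect (Pi_pmf {e. e \<subseteq> {1..n} \<and> card e = r} False (\<lambda>_. bernoulli_pmf p))"

definition complete_bipartite :: "'a set \<Rightarrow> 'a set \<Rightarrow> 'a set set" where
  "complete_bipartite A B = {{a, b} | a b. a \<in> A \<and> b \<in> B}"

definition initial_graph :: "nat \<Rightarrow> nat set \<Rightarrow> nat set set" where
  "initial_graph n V = complete_bipartite V ({1..n} - V)"

definition vertex_pairs :: "nat \<Rightarrow> (nat \<times> nat) set" where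
  "vertex_pairs n = {(x, y). x \<in> {1..n} \<and> y \<in> {1..n} \<and> x \<noteq> y}"

definition admissible ::
    "nat \<Rightarrow> nat \<Rightarrow> nat set set \<Rightarrow> nat set set \<Rightarrow> nat \<times> nat \<Rightarrow> bool" where
  "admissible r n H G = (\<lambda>(x, y). \<exists>Z. Z \<subseteq> {1..n} - {x, y} \<and> card Z = r - 2 \<and>
     (\<forall>z\<in>Z. {x, z} \<in> G \<and> {y, z} \<in> G) \<and> {x, y} \<union> Z \<in> H)"

definition triadic_step ::
    "nat \<Rightarrow> nat \<Rightarrow> nat set set \<Rightarrow> nat set set \<Rightarrow> nat \<times> nat \<Rightarrow> nat set set" where
  "triadic_step r n H G q = (if admissible r n H G q then insert {fst q, snd q} G else G)"

primrec triadic_graph ::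
    "nat \<Rightarrow> nat \<Rightarrow> nat set \<Rightarrow> nat set set \<Rightarrow> (nat \<times> nat) stream \<Rightarrow> nat \<Rightarrow> nat set set" where
  "triadic_graph r n V H s 0 = initial_graph n V"
| "triadic_graph r n V H s (Suc t) = triadic_step r n H (triadic_graph r n V H s t) (s !! t)"

definition stuck :: "nat \<Rightarrow> nat \<Rightarrow> nat set set \<Rightarrow> nat set set \<Rightarrow> bool" where
  "stuck r n H G \<longleftrightarrow> (\<forall>(x, y) \<in> vertex_pairs n. admissible r n H G (x, y) \<longrightarrow> {x, y} \<in> G)"

text \<open>The process stops almost surely, since almost surely every pair is chosen infinitely often;
  on the remaining null set the least stopping time is an arbitrary number.\<close>

definition final_graph ::
    "nat \<Rightarrow> nat \<Rightarrow> nat set \<Rightarrow> nat set set \<Rightarrow> (nat \<times> nat) stream \<Rightarrow> nat set set" where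
  "final_graph r n V H s =
     triadic_graph r n V H s (LEAST t. stuck r n H (triadic_graph r n V H s t))"

definition added_edges ::
    "nat \<Rightarrow> nat \<Rightarrow> nat set \<Rightarrow> nat set set \<times> (nat \<times> nat) stream \<Rightarrow> nat" where
  "added_edges r n V = (\<lambda>(H, s). card (final_graph r n V H s - initial_graph n V))"

text \<open>The hypergraph is sampled once, independently of the i.i.d. uniform choices of pairs. For
  \<open>n < 2\<close> there are no pairs and the distribution of the choices is unspecified.\<close>

definition triadic_space ::
    "nat \<Rightarrow> nat \<Rightarrow> real \<Rightarrow> (nat set set \<times> (nat \<times> nat) stream) measure" where
  "triadic_space r n p =
     measure_pmf (random_hypergraph r n p) \<Otimes>\<^sub>M
     stream_space (measure_pmf (pmf_of_set (vertex_pairs n)))"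

end

theory Submission
  imports Defs "HOL-Real_Asymp.Real_Asymp"
begin

text \<open>
  The hyperedges containing \<open>V\<close> each add one edge, and their number is binomial with mean about
  \<open>n\<^sup>2 p / 2\<close>; it remains to see that all others add only \<open>o(n\<^sup>2 p)\<close> edges. Ask one by one about those
  hyperedges whose cross edges are already present, as long as all degrees outside \<open>V\<close> are at most
  \<open>D = O(n p + ln n)\<close> and all codegrees at most \<open>K = (ln n) powr (2 \<alpha>)\<close>. Under these bounds only
  \<open>O(n + D\<^sup>2 K^(r-3))\<close> questions concern a given vertex, \<open>O(D K^(r-2))\<close> can change a given codegree,
  and \<open>O(n D\<^sup>2 K^(r-3))\<close> concern hyperedges not containing \<open>V\<close>. The answers are independent of the past,
  so \<open>2 ^ hits / (1 + p) ^ tries\<close> is a martingale for each of these counters, and Markov's inequality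
  bounds the probability that it gets too many positive answers. Since
  \<open>n p\<^sup>2 K^(r-3) \<longlonglongrightarrow> 0\<close> and \<open>K\<close> exceeds every multiple of \<open>ln n\<close>, with high probability no degree or
  codegree bound is ever violated, and the last counter is \<open>o(n\<^sup>2 p)\<close>.
\<close>

section \<open>Adaptive exposure of a random set\<close>

text \<open>A history lists the elements asked so far together with the answers, newest first.\<close>

primrec expose ::
    "(('a \<times> bool) list \<Rightarrow> 'a option) \<Rightarrow> ('a \<Rightarrow> bool) \<Rightarrow> nat \<Rightarrow> ('a \<times> bool) list \<Rightarrow> ('a \<times> bool) list" where
  "expose qry b 0 h = h"
| "expose qry b (Suc k) h =
     (case qry h of None \<Rightarrow> h | Some f \<Rightarrow> expose qry b k ((f, b f) # h))"

text \<open>The rule \<open>ty\<close> sees the history before the question and the element, but not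
  the answer. This predictability is what makes the later potential a martingale.\<close>

primrec tried :: "(('a \<times> bool) list \<Rightarrow> 'a \<Rightarrow> bool) \<Rightarrow> ('a \<times> bool) list \<Rightarrow> 'a set" where
  "tried ty [] = {}"
| "tried ty (q # h) = (if ty h (fst q) then insert (fst q) (tried ty h) else tried ty h)"

primrec hits :: "(('a \<times> bool) list \<Rightarrow> 'a \<Rightarrow> bool) \<Rightarrow> ('a \<times> bool) list \<Rightarrow> 'a set" where
  "hits ty [] = {}"
| "hits ty (q # h) = (if snd q \<and> ty h (fst q) then insert (fst q) (hits ty h) else hits ty h)"

definition asked :: "('a \<times> bool) list \<Rightarrow> 'a set" where
  "asked h = fst ` set h"

definition found :: "('a \<times> bool) list \<Rightarrow> 'a set" where
  "found h = {f. (f, True) \<in> set h}"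

lemma asked_simps [simp]: "asked [] = {}" "asked (q # h) = insert (fst q) (asked h)"
  by (auto simp: asked_def)

lemma found_simps [simp]: "found [] = {}"
  "found (q # h) = (if snd q then insert (fst q) (found h) else found h)"
  by (auto simp: found_def prod_eq_iff)

lemma finite_asked [simp]: "finite (asked h)"
  by (simp add: asked_def)

lemma found_subset_asked: "found h \<subseteq> asked h"
  by (force simp: asked_def found_def)

lemma finite_found [simp]: "finite (found h)"
  using finite_subset[OF found_subset_asked] by simp

lemma tried_subset: "tried ty h \<subseteq> asked h"
  by (induction h) auto

lemma hits_subset: "hits ty h \<subseteq> found h"
  by (induction h) auto

lemma finite_tried [simp]: "finite (tried ty h)"
  using finite_subset[OF tried_subset] by simp

lemma finite_hits [simp]: "finite (hits ty h)"
  using finite_subset[OF hits_subset] by simp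

text \<open>Histories along an exposure of \<open>b\<close>, freed from the step counter of
  \<open>expose\<close>, so that invariants can be proved by rule induction.\<close>

inductive reachable :: "(('a \<times> bool) list \<Rightarrow> 'a option) \<Rightarrow> ('a \<Rightarrow> bool) \<Rightarrow> ('a \<times> bool) list \<Rightarrow> bool"
  for qry b where
  "reachable qry b []"
| "reachable qry b h \<Longrightarrow> qry h = Some f \<Longrightarrow> reachable qry b ((f, b f) # h)"

lemma reachable_expose: "reachable qry b h \<Longrightarrow> reachable qry b (expose qry b k h)"
  by (induction k arbitrary: h) (auto split: option.split intro: reachable.intros)

lemma reachable_found:
  "reachable qry b h \<Longrightarrow> found h = {f \<in> asked h. b f}"
  by (induction rule: reachable.induct) auto

text \<open>Each question removes one element from \<open>A - asked h\<close>, so a step budget of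
  that size lets the exposure run to its end.\<close>

lemma expose_terminal:
  assumes "finite A" and "\<And>h f. qry h = Some f \<Longrightarrow> f \<in> A \<and> f \<notin> asked h"
    and "card (A - asked h) \<le> k"
  shows "qry (expose qry b k h) = None"
  using assms(3)
proof (induction k arbitrary: h)
  case 0
  then have "A - asked h = {}" using assms(1) by simp
  then show ?case using assms(2)[of h] by (cases "qry h") auto
next
  case (Suc k)
  show ?case
  proof (cases "qry h")
    case (Some f)
    have "f \<in> A - asked h" using assms(2)[OF Some] by simp
    moreover have "A - asked ((f, b f) # h) = (A - asked h) - {f}" by auto
    ultimately have "card (A - asked ((f, b f) # h)) \<le> k"
      using Suc.prems assms(1) by (simp add: card_Diff_singleton)
    then show ?thesis using Suc.IH Some by simp
  qed simp
qed

text \<open>No element is asked twice, so the future of the exposure reads \<open>b\<close> only at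
  elements not asked yet.\<close>

lemma expose_cong:
  assumes "\<And>h f. qry h = Some f \<Longrightarrow> f \<notin> asked h"
    and "\<And>f. f \<notin> asked h \<Longrightarrow> b f = b' f"
  shows "expose qry b k h = expose qry b' k h"
  using assms(2)
proof (induction k arbitrary: h)
  case (Suc k)
  show ?case
  proof (cases "qry h")
    case (Some f)
    then have "b f = b' f" using assms(1) Suc.prems by blast
    moreover have "expose qry b k ((f, b' f) # h) = expose qry b' k ((f, b' f) # h)"
      by (rule Suc.IH) (use Suc.prems in auto)
    ultimately show ?thesis using Some by simp
  qed simp
qed simp

text \<open>Optional stopping for a nonnegative supermartingale. The induction keeps
  \<open>h\<close> general and randomizes only the coordinates outside \<open>asked h\<close>; the
  coordinate asked next is split off as an independent Bernoulli variable.\<close>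

lemma nn_integral_expose_le:
  fixes p :: real and \<Phi> :: "('a \<times> bool) list \<Rightarrow> real"
  assumes A: "finite A" and qry: "\<And>h f. qry h = Some f \<Longrightarrow> f \<in> A \<and> f \<notin> asked h"
    and p: "0 \<le> p" "p \<le> 1" and nonneg: "\<And>h. 0 \<le> \<Phi> h"
    and super: "\<And>h f. qry h = Some f \<Longrightarrow>
      p * \<Phi> ((f, True) # h) + (1 - p) * \<Phi> ((f, False) # h) \<le> \<Phi> h"
  shows "(\<integral>\<^sup>+ b. ennreal (\<Phi> (expose qry b k h))
           \<partial>measure_pmf (Pi_pmf (A - asked h) False (\<lambda>_. bernoulli_pmf p))) \<le> ennreal (\<Phi> h)"
proof (induction k arbitrary: h)
  case 0
  then show ?case by (simp add: measure_pmf.emeasure_space_1)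
next
  case (Suc k)
  show ?case
  proof (cases "qry h")
    case None
    then show ?thesis by (simp add: measure_pmf.emeasure_space_1)
  next
    case (Some f)
    define B where "B = A - asked h - {f}"
    let ?P = "Pi_pmf B False (\<lambda>_. bernoulli_pmf p)"
    have f: "f \<in> A" "f \<notin> asked h" using qry[OF Some] by auto
    have AB: "A - asked h = insert f B" using f by (auto simp: B_def)
    have BB: "A - asked ((f, y) # h) = B" for y by (auto simp: B_def)
    have B: "finite B" "f \<notin> B" using A by (auto simp: B_def)
    \<comment> \<open>Once \<open>f\<close> has been asked it is never read again, so the remaining
      exposure depends only on the other coordinates.\<close>
    have upd: "expose qry (b(f := y)) (Suc k) h = expose qry b k ((f, y) # h)" for b y
    proof -
      have "expose qry (b(f := y)) k ((f, y) # h) = expose qry b k ((f, y) # h)"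
        by (rule expose_cong) (use qry in auto)
      then show ?thesis using Some by simp
    qed
    have "(\<integral>\<^sup>+ b. ennreal (\<Phi> (expose qry b (Suc k) h))
             \<partial>measure_pmf (Pi_pmf (A - asked h) False (\<lambda>_. bernoulli_pmf p))) =
          (\<integral>\<^sup>+ y. (\<integral>\<^sup>+ b. ennreal (\<Phi> (expose qry b k ((f, y) # h))) \<partial>measure_pmf ?P)
             \<partial>measure_pmf (bernoulli_pmf p))"
      unfolding AB Pi_pmf_insert'[OF B] by (simp add: upd del: expose.simps)
    also have "\<dots> \<le> (\<integral>\<^sup>+ y. ennreal (\<Phi> ((f, y) # h)) \<partial>measure_pmf (bernoulli_pmf p))"
      using Suc.IH[of "(f, y) # h" for y] unfolding BB by (intro nn_integral_mono) auto
    also have "\<dots> = ennreal (p * \<Phi> ((f, True) # h) + (1 - p) * \<Phi> ((f, False) # h))"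
      using p nonneg by (simp add: ennreal_mult ennreal_plus mult.commute)
    also have "\<dots> \<le> ennreal (\<Phi> h)" using super[OF Some] by (rule ennreal_leI)
    finally show ?thesis .
  qed
qed

text \<open>An exponential Markov bound. A counted question multiplies the numerator by 2 with
  probability \<open>p\<close> and by 1 otherwise, hence by \<open>1 + p\<close> on average, which
  the denominator cancels. With \<open>1 + p \<le> exp p\<close> and at most \<open>N\<close>
  counted questions, \<open>s\<close> hits force the potential up to \<open>c\<close>.\<close>

lemma prob_hits_ge:
  fixes p s N :: real
  assumes A: "finite A" and qry: "\<And>h f. qry h = Some f \<Longrightarrow> f \<in> A \<and> f \<notin> asked h"
    and p: "0 \<le> p" "p \<le> 1"
    and N: "\<And>b. real (card (tried ty (expose qry b k []))) \<le> N"
  shows "measure_pmf.prob (Pi_pmf A False (\<lambda>_. bernoulli_pmf p))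
           {b. s \<le> real (card (hits ty (expose qry b k [])))} \<le> exp (p * N - s * ln 2)"
proof -
  let ?P = "Pi_pmf A False (\<lambda>_. bernoulli_pmf p)"
  \<comment> \<open>a martingale, whichever adaptive rule \<open>ty\<close> selects the elements to be counted\<close>
  define \<Phi> where "\<Phi> h = 2 ^ card (hits ty h) / (1 + p) ^ card (tried ty h)"
    for h :: "('a \<times> bool) list"
  define c where "c = exp (s * ln 2 - p * N)"
  have super: "p * \<Phi> ((f, True) # h) + (1 - p) * \<Phi> ((f, False) # h) \<le> \<Phi> h" if "qry h = Some f" for h f
  proof -
    have "f \<notin> asked h" using qry[OF that] by simp
    then have f: "f \<notin> tried ty h" "f \<notin> hits ty h"
      using tried_subset[of ty h] hits_subset[of ty h] found_subset_asked[of h] by auto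
    show ?thesis
    proof (cases "ty h f")
      case True
      have "\<Phi> ((f, True) # h) = \<Phi> h * 2 / (1 + p)" "\<Phi> ((f, False) # h) = \<Phi> h / (1 + p)"
        using True f by (simp_all add: \<Phi>_def mult.commute)
      then have "p * \<Phi> ((f, True) # h) + (1 - p) * \<Phi> ((f, False) # h) = \<Phi> h * (1 + p) / (1 + p)"
        by (simp add: add_divide_distrib[symmetric] algebra_simps)
      also have "\<dots> = \<Phi> h" using p by simp
      finally show ?thesis by simp
    next
      case False
      then have "\<Phi> ((f, b) # h) = \<Phi> h" for b by (simp add: \<Phi>_def)
      then show ?thesis by (simp add: algebra_simps)
    qed
  qed
  have ge: "c \<le> \<Phi> (expose qry b k [])" if "s \<le> real (card (hits ty (expose qry b k [])))" for b
  proof -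
    let ?h = "expose qry b k []"
    have "(1 + p) ^ card (tried ty ?h) \<le> exp p ^ card (tried ty ?h)"
      using p by (intro power_mono) auto
    also have "\<dots> = exp (p * real (card (tried ty ?h)))"
      by (simp flip: exp_of_nat2_mult)
    also have "\<dots> \<le> exp (p * N)" using p N[of b] by (simp add: mult_left_mono)
    finally have den: "(1 + p) ^ card (tried ty ?h) \<le> exp (p * N)" .
    have "exp (s * ln 2) \<le> exp (real (card (hits ty ?h)) * ln 2)" using that by simp
    also have "\<dots> = 2 ^ card (hits ty ?h)" by (subst exp_of_nat_mult) simp
    finally have num: "exp (s * ln 2) \<le> 2 ^ card (hits ty ?h)" .
    show ?thesis unfolding c_def \<Phi>_def exp_diff using p
      by (intro frac_le num den) (auto intro: zero_less_power)
  qed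
  \<comment> \<open>Markov's inequality; the potential starts at 1 on the empty history.\<close>
  have "emeasure ?P {b. s \<le> real (card (hits ty (expose qry b k [])))}
      \<le> emeasure ?P {b \<in> UNIV. 1 \<le> ennreal (1 / c) * ennreal (\<Phi> (expose qry b k []))}"
    using ge p by (intro emeasure_mono)
      (auto simp: c_def \<Phi>_def ennreal_mult[symmetric] divide_simps simp flip: ennreal_1 intro!: ennreal_leI)
  also have "\<dots> \<le> ennreal (1 / c) * (\<integral>\<^sup>+ b. ennreal (\<Phi> (expose qry b k [])) * indicator UNIV b \<partial>?P)"
    by (intro nn_integral_Markov_inequality) auto
  also have "\<dots> \<le> ennreal (1 / c) * ennreal (\<Phi> [])"
    using nn_integral_expose_le[OF A qry p _ super, where k = k and h = "[]"] p
    by (intro mult_left_mono) (auto simp: \<Phi>_def)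
  also have "\<dots> = ennreal (1 / c)" by (simp add: \<Phi>_def)
  finally have "measure ?P {b. s \<le> real (card (hits ty (expose qry b k [])))} \<le> 1 / c"
    by (subst (asm) measure_pmf.emeasure_eq_measure) (auto simp: c_def)
  then show ?thesis by (simp add: c_def exp_diff)
qed

section \<open>Number of hyperedges in a fixed set\<close>

lemma expectation_Pi_pmf_insert_bernoulli:
  fixes g :: "('a \<Rightarrow> bool) \<Rightarrow> real"
  assumes "finite A" "x \<notin> A" "0 \<le> p" "p \<le> 1"
  shows "measure_pmf.expectation (Pi_pmf (insert x A) False (\<lambda>_. bernoulli_pmf p)) g =
    p * measure_pmf.expectation (Pi_pmf A False (\<lambda>_. bernoulli_pmf p)) (\<lambda>b. g (b(x := True))) +
    (1 - p) * measure_pmf.expectation (Pi_pmf A False (\<lambda>_. bernoulli_pmf p)) (\<lambda>b. g (b(x := False)))"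
proof -
  have fin: "finite (set_pmf (Pi_pmf A False (\<lambda>_. bernoulli_pmf p)))"
    unfolding set_Pi_pmf[OF assms(1)] using assms(1) by (intro finite_PiE_dflt) auto
  have "Pi_pmf (insert x A) False (\<lambda>_. bernoulli_pmf p) =
      bernoulli_pmf p \<bind> (\<lambda>y. map_pmf (\<lambda>b. b(x := y)) (Pi_pmf A False (\<lambda>_. bernoulli_pmf p)))"
    by (simp add: Pi_pmf_insert'[OF assms(1,2)] map_pmf_def)
  then show ?thesis using assms(3,4) fin
    by (simp only:, subst pmf_expectation_bind[of UNIV]) (auto simp: UNIV_bool)
qed

text \<open>Mean and variance are proved together by induction over \<open>A\<close>, because the
  variance step needs the mean.\<close>

lemma
  fixes p :: real
  assumes "finite A" "0 \<le> p" "p \<le> 1"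
  shows expectation_card_bernoulli:
      "measure_pmf.expectation (Pi_pmf A False (\<lambda>_. bernoulli_pmf p)) (\<lambda>b. real (card {x \<in> A. b x})) = p * card A" (is "?E A")
    and variance_card_bernoulli:
      "measure_pmf.expectation (Pi_pmf A False (\<lambda>_. bernoulli_pmf p))
         (\<lambda>b. (real (card {x \<in> A. b x}) - p * card A)\<^sup>2) = p * (1 - p) * card A" (is "?V A")
proof -
  have "?E A \<and> ?V A" using assms(1)
  proof (induction A)
    case empty
    then show ?case by simp
  next
    case (insert x A)
    let ?P = "Pi_pmf A False (\<lambda>_. bernoulli_pmf p)"
    let ?c = "\<lambda>b. real (card {x \<in> A. b x})"
    have [simp]: "integrable (measure_pmf ?P) g" for g :: "_ \<Rightarrow> real"
      by (rule integrable_measure_pmf_finite)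
         (unfold set_Pi_pmf[OF insert(1)], use insert(1) in \<open>auto intro!: finite_PiE_dflt\<close>)
    have up: "real (card {z \<in> insert x A. (b(x := y)) z}) = ?c b + of_bool y" for b y
    proof -
      have "{z \<in> insert x A. (b(x := y)) z} = (if y then insert x {z \<in> A. b z} else {z \<in> A. b z})"
        using insert(2) by auto
      then show ?thesis using insert(1,2) by simp
    qed
    have E: "measure_pmf.expectation ?P ?c = p * card A" using insert by simp
    have V: "measure_pmf.expectation ?P (\<lambda>b. (?c b - p * card A)\<^sup>2) = p * (1 - p) * card A"
      using insert by simp
    \<comment> \<open>Conditioned on the value \<open>y\<close> of the new coordinate, the centred
      count is shifted by \<open>d = of_bool y - p\<close>; the cross term vanishes because the
      centred count has mean 0.\<close>
    have shift: "measure_pmf.expectation ?P (\<lambda>b. (?c b - p * card A + d)\<^sup>2) = p * (1 - p) * card A + d\<^sup>2" for d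
    proof -
      have "measure_pmf.expectation ?P (\<lambda>b. (?c b - p * card A + d)\<^sup>2) =
          measure_pmf.expectation ?P (\<lambda>b. (?c b - p * card A)\<^sup>2 + 2 * d * (?c b - p * card A) + d\<^sup>2)"
        by (intro Bochner_Integration.integral_cong) (auto simp: power2_eq_square algebra_simps)
      also have "\<dots> = p * (1 - p) * card A + d\<^sup>2"
        using V E by (simp add: measure_pmf.prob_space)
      finally show ?thesis .
    qed
    have "?E (insert x A)"
      unfolding expectation_Pi_pmf_insert_bernoulli[OF insert(1,2) assms(2,3)] up
      using E insert(1,2) by (simp add: algebra_simps)
    moreover have "?V (insert x A)"
    proof -
      have eq: "?c b + of_bool y - p * card (insert x A) = ?c b - p * card A + (of_bool y - p)" for b y
        using insert(1,2) by (simp add: algebra_simps)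
      show ?thesis
        unfolding expectation_Pi_pmf_insert_bernoulli[OF insert(1,2) assms(2,3)] up eq shift
        using insert(1,2) by (simp add: power2_eq_square algebra_simps)
    qed
    ultimately show ?case ..
  qed
  then show "?E A" "?V A" by auto
qed

text \<open>Chebyshev's inequality after projecting to the coordinates in \<open>B\<close>, with the
  factor \<open>1 - p\<close> of the variance dropped.\<close>

lemma prob_card_deviation:
  fixes p d :: real
  assumes "finite A" "B \<subseteq> A" "0 \<le> p" "p \<le> 1" "0 < d"
  shows "measure_pmf.prob (Pi_pmf A False (\<lambda>_. bernoulli_pmf p))
    {b. d \<le> \<bar>real (card {x \<in> B. b x}) - p * card B\<bar>} \<le> p * card B / d\<^sup>2"
proof -
  have B: "finite B" using assms finite_subset by blast
  let ?P = "Pi_pmf B False (\<lambda>_. bernoulli_pmf p)"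
  let ?c = "\<lambda>b. real (card {x \<in> B. b x})"
  have int: "integrable (measure_pmf ?P) g" for g :: "_ \<Rightarrow> real"
    by (rule integrable_measure_pmf_finite)
       (unfold set_Pi_pmf[OF B], use B in \<open>auto intro!: finite_PiE_dflt\<close>)
  have "measure_pmf.prob (Pi_pmf A False (\<lambda>_. bernoulli_pmf p)) {b. d \<le> \<bar>?c b - p * card B\<bar>}
      = measure_pmf.prob ?P {b. d \<le> \<bar>?c b - p * card B\<bar>}"
    unfolding Pi_pmf_subset[OF assms(1,2)] measure_map_pmf vimage_def
    by (intro arg_cong[of _ _ "measure_pmf.prob _"] Collect_cong) (simp cong: conj_cong)
  also have "\<dots> \<le> p * (1 - p) * card B / d\<^sup>2"
    using measure_pmf.Chebyshev_inequality[of ?c ?P d] int assms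
    by (simp add: expectation_card_bernoulli[OF B assms(3,4)] variance_card_bernoulli[OF B assms(3,4)])
  also have "\<dots> \<le> p * card B / d\<^sup>2"
    using assms by (intro divide_right_mono mult_right_mono) (auto simp: mult_left_le)
  finally show ?thesis .
qed

section \<open>From every fixed tolerance to a single vanishing tolerance\<close>

lemma ex_tendsto_zero_diagonal:
  fixes g :: "real \<Rightarrow> nat \<Rightarrow> real"
  assumes "\<And>d. d > 0 \<Longrightarrow> g d \<longlonglongrightarrow> 1"
  shows "\<exists>\<epsilon> :: nat \<Rightarrow> real. \<epsilon> \<longlonglongrightarrow> 0 \<and> (\<lambda>n. g (\<epsilon> n) n) \<longlonglongrightarrow> 1"
proof -
  \<comment> \<open>Tolerance \<open>1 / (k + 1)\<close> is honoured from \<open>n\<close> onwards.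
    Allowing \<open>k = 0\<close> unconditionally makes the set whose maximum is \<open>kk n\<close>
    nonempty.\<close>
  define ok where "ok k n \<longleftrightarrow> k = 0 \<or> (\<forall>m\<ge>n. \<bar>g (1 / (real k + 1)) m - 1\<bar> < 1 / (real k + 1))" for k n :: nat
  define kk where "kk n = Max {k. k \<le> n \<and> ok k n}" for n
  have fin: "finite {k. k \<le> n \<and> ok k n}" for n by simp
  have kk: "ok (kk n) n" for n
  proof -
    have "{k. k \<le> n \<and> ok k n} \<noteq> {}" by (auto simp: ok_def)
    then show ?thesis using Max_in[OF fin] unfolding kk_def by blast
  qed
  have top: "filterlim kk at_top sequentially"
    unfolding filterlim_at_top
  proof
    fix k :: nat
    have "\<forall>\<^sub>F m in sequentially. \<bar>g (1 / (real k + 1)) m - 1\<bar> < 1 / (real k + 1)"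
      using tendstoD[OF assms[of "1 / (real k + 1)"], of "1 / (real k + 1)"] by (simp add: dist_real_def)
    then obtain N where N: "\<And>m. N \<le> m \<Longrightarrow> \<bar>g (1 / (real k + 1)) m - 1\<bar> < 1 / (real k + 1)"
      unfolding eventually_sequentially by blast
    have "k \<le> kk n" if "max N k \<le> n" for n
      unfolding kk_def using that N by (intro Max_ge[OF fin]) (auto simp: ok_def)
    then show "\<forall>\<^sub>F n in sequentially. k \<le> kk n"
      unfolding eventually_sequentially by blast
  qed
  define \<epsilon> where "\<epsilon> n = 1 / (real (kk n) + 1)" for n
  have inv: "(\<lambda>k::nat. 1 / (real k + 1)) \<longlonglongrightarrow> 0"
    using LIMSEQ_inverse_real_of_nat by (simp add: inverse_eq_divide add.commute)
  have eps: "\<epsilon> \<longlonglongrightarrow> 0" unfolding \<epsilon>_def by (rule filterlim_compose[OF inv top])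
  \<comment> \<open>As soon as \<open>kk n\<close> is at least 1, the free case \<open>k = 0\<close>
    of \<open>ok\<close> no longer interferes.\<close>
  have "\<forall>\<^sub>F n in sequentially. norm (g (\<epsilon> n) n - 1) \<le> \<epsilon> n"
    using filterlim_at_top[THEN iffD1, OF top, rule_format, of 1]
  proof eventually_elim
    case (elim n)
    then show ?case using kk[of n] by (auto simp: ok_def \<epsilon>_def intro: less_imp_le)
  qed
  then have "(\<lambda>n. g (\<epsilon> n) n - 1) \<longlonglongrightarrow> 0" by (rule Lim_null_comparison[OF _ eps])
  then have "(\<lambda>n. g (\<epsilon> n) n) \<longlonglongrightarrow> 1" by (simp add: LIM_zero_iff)
  then show ?thesis using eps by blast
qed

section \<open>The process terminates and the number of added edges is measurable\<close>

lemma triadic_graph_mono: "triadic_graph r n V H s t \<subseteq> triadic_graph r n V H s (t + k)"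
  by (induction k) (auto simp: triadic_step_def)

lemma triadic_graph_bounded:
  assumes "V \<subseteq> {1..n}" "H \<subseteq> Pow {1..n}"
  shows "triadic_graph r n V H s t \<subseteq> Pow {1..n}"
proof (induction t)
  case 0
  then show ?case using assms by (auto simp: initial_graph_def complete_bipartite_def)
next
  case (Suc t)
  then show ?case using assms(2) by (cases "s !! t") (auto simp: triadic_step_def admissible_def)
qed

text \<open>The graphs grow inside a finite set, so they are constant from some \<open>t0\<close>
  on. A pair admissible at \<open>t0\<close> is chosen again later, and its edge must already be
  present because nothing changes any more.\<close>

lemma ex_stuck:
  assumes "V \<subseteq> {1..n}" "H \<subseteq> Pow {1..n}"
    and io: "\<And>q k. q \<in> vertex_pairs n \<Longrightarrow> \<exists>t\<ge>k. s !! t = q"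
  shows "\<exists>t. stuck r n H (triadic_graph r n V H s t)"
proof -
  let ?g = "triadic_graph r n V H s"
  have fin: "finite (?g t)" for t
    by (rule finite_subset[OF triadic_graph_bounded[OF assms(1,2)]]) simp
  have "card (?g t) \<le> card (Pow {1..n})" for t
    by (intro card_mono triadic_graph_bounded assms) simp
  then have "\<exists>t0. \<forall>t. card (?g t) \<le> card (?g t0)"
    using ex_has_greatest_nat[of "\<lambda>_. True" 0 "\<lambda>t. card (?g t)" "Suc (card (Pow {1..n}))"]
    by (auto simp: less_Suc_eq_le)
  then obtain t0 where t0: "\<And>t. card (?g t) \<le> card (?g t0)" by blast
  have const: "?g t = ?g t0" if "t0 \<le> t" for t
    using card_seteq[OF fin, of "?g t0" t] t0[of t] triadic_graph_mono[of r n V H s t0 "t - t0"] that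
    by simp
  have "{x, y} \<in> ?g t0" if xy: "(x, y) \<in> vertex_pairs n" "admissible r n H (?g t0) (x, y)" for x y
  proof -
    obtain t where t: "t0 \<le> t" "s !! t = (x, y)" using io[OF xy(1)] by blast
    then have "{x, y} \<in> ?g (Suc t)" using const[of t] xy(2) by (simp add: triadic_step_def)
    then show ?thesis using const[of "Suc t"] t(1) by simp
  qed
  then show ?thesis unfolding stuck_def by (intro exI[of _ t0]) auto
qed

text \<open>Splitting off the first letter, the event \<open>E\<close> of never seeing
  \<open>q\<close> satisfies \<open>prob E = prob E * (1 - pmf Q q)\<close>, hence is null.
  Induction on \<open>k\<close>, again by splitting off the first letter, gives occurrences beyond
  every \<open>k\<close>.\<close>

lemma AE_stream_infinitely_often:
  assumes "q \<in> set_pmf Q"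
  shows "AE s in stream_space (measure_pmf Q). \<exists>t\<ge>k. s !! t = q"
proof -
  let ?S = "stream_space (measure_pmf Q)"
  interpret S: prob_space ?S by (rule prob_space.prob_space_stream_space) (rule measure_pmf.prob_space_axioms)
  have snth [measurable]: "(\<lambda>s. s !! t) \<in> measurable ?S (count_space UNIV)" for t
    using measurable_snth[of t "measure_pmf Q"] by simp
  define E where "E = {s \<in> space ?S. \<forall>t. s !! t \<noteq> q}"
  have E: "E \<in> sets ?S" unfolding E_def by measurable
  \<comment> \<open>A first letter \<open>q\<close> rules \<open>E\<close> out; any other first
    letter leaves the condition on the rest unchanged.\<close>
  have step: "emeasure ?S {s \<in> space ?S. x ## s \<in> E} = emeasure ?S E * indicator (- {q}) x" for x
  proof (cases "x = q")
    case True
    then have empty: "{s \<in> space ?S. x ## s \<in> E} = {}" by (auto simp: E_def intro: exI[of _ 0])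
    show ?thesis unfolding empty using True by simp
  next
    case False
    have "(\<forall>t. (x ## s) !! t \<noteq> q) \<longleftrightarrow> (\<forall>t. s !! t \<noteq> q)" for s
      using False by (metis not0_implies_Suc snth.simps stream.sel)
    then have "{s \<in> space ?S. x ## s \<in> E} = E" by (auto simp: E_def space_stream_space streams_iff_sset)
    then show ?thesis using False by simp
  qed
  have "emeasure ?S E = (\<integral>\<^sup>+ x. emeasure ?S {s \<in> space ?S. x ## s \<in> E} \<partial>measure_pmf Q)"
    by (rule prob_space.emeasure_stream_space[OF measure_pmf.prob_space_axioms E])
  also have "\<dots> = emeasure ?S E * emeasure Q (- {q})"
    unfolding step by (subst nn_integral_cmult) (auto simp: nn_integral_indicator)
  finally have eq: "S.prob E = S.prob E * measure Q (- {q})"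
    by (simp add: S.emeasure_eq_measure measure_pmf.emeasure_eq_measure flip: ennreal_mult)
  have "measure Q (- {q}) = 1 - pmf Q q"
    using measure_pmf.prob_compl[of "{q}" Q] by (simp add: measure_pmf_single Compl_eq_Diff_UNIV)
  moreover have "pmf Q q > 0" using assms by (simp add: pmf_positive)
  ultimately have "S.prob E = 0" using eq by (simp add: algebra_simps)
  then have "E \<in> null_sets ?S" using E by (simp add: null_sets_def S.emeasure_eq_measure)
  then have base: "AE s in ?S. \<exists>t. s !! t = q" by (rule AE_I') (auto simp: E_def)
  show ?thesis
  proof (induction k)
    case 0
    then show ?case using base by simp
  next
    case (Suc k)
    have "AE s in ?S. \<exists>t\<ge>Suc k. (x ## s) !! t = q" for x
      using Suc by eventually_elim (metis Suc_le_mono snth.simps(2) stream.sel(2))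
    moreover have "Measurable.pred ?S (\<lambda>s. \<exists>t\<ge>Suc k. s !! t = q)" by measurable
    ultimately show ?case
      by (subst prob_space.AE_stream_space[OF measure_pmf.prob_space_axioms]) auto
  qed
qed

text \<open>The graph at each time lies in the countable set \<open>I\<close> of finite sets of
  finite edges, whatever the hypergraph is. Countably many values allow every composition, including
  the one with the least stopping time, to be handled value by value.\<close>

lemma measurable_added_edges:
  fixes M :: "nat set set pmf" and Q :: "(nat \<times> nat) pmf"
  assumes V: "V \<subseteq> {1..n}"
  shows "added_edges r n V \<in> measurable (measure_pmf M \<Otimes>\<^sub>M stream_space (measure_pmf Q)) (count_space UNIV)"
proof -
  let ?P = "measure_pmf M \<Otimes>\<^sub>M stream_space (measure_pmf Q)"
  define I :: "nat set set set" where "I = {G. finite G \<and> G \<subseteq> {e. finite e}}"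
  have I: "countable I" unfolding I_def by (intro countable_Collect_finite_subset countable_Collect_finite)
  have snth: "(\<lambda>\<omega>. snd \<omega> !! t) \<in> measurable ?P (count_space UNIV)" for t
    using measurable_compose[OF measurable_snd measurable_snth[of t "measure_pmf Q"], of "measure_pmf M"]
    by simp
  have fst: "(\<lambda>\<omega>. F (fst \<omega>)) \<in> measurable ?P (count_space UNIV)" for F :: "nat set set \<Rightarrow> 'c"
    by (rule measurable_compose[OF measurable_fst]) simp
  have G: "(\<lambda>\<omega>. triadic_graph r n V (fst \<omega>) (snd \<omega>) t) \<in> measurable ?P (count_space I)" for t
  proof (induction t)
    case 0
    have "initial_graph n V \<subseteq> Pow {1..n}"
      using V by (auto simp: initial_graph_def complete_bipartite_def)
    then have "initial_graph n V \<in> I"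
      unfolding I_def using finite_subset[of "initial_graph n V" "Pow {1..n}"] finite_subset[of _ "{1..n}"]
      by auto
    then show ?case by simp
  next
    case (Suc t)
    have "(\<lambda>\<omega>. triadic_step r n (fst \<omega>) G q) \<in> measurable ?P (count_space I)" if "G \<in> I" for G q
    proof -
      have "triadic_step r n H G q \<in> I" for H using that by (auto simp: triadic_step_def I_def)
      then show ?thesis by (intro measurable_compose[OF measurable_fst]) simp
    qed
    then have "(\<lambda>\<omega>. triadic_step r n (fst \<omega>) (triadic_graph r n V (fst \<omega>) (snd \<omega>) t) q)
        \<in> measurable ?P (count_space I)" for q
      by (rule measurable_compose_countable'[OF _ Suc I])
    then show ?case using measurable_compose_countable[OF _ snth[of t]] by simp
  qed
  have "Measurable.pred ?P (\<lambda>\<omega>. stuck r n (fst \<omega>) (triadic_graph r n V (fst \<omega>) (snd \<omega>) t))" for t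
    by (rule measurable_compose_countable'[OF fst G I])
  then have L: "(\<lambda>\<omega>. LEAST t. stuck r n (fst \<omega>) (triadic_graph r n V (fst \<omega>) (snd \<omega>) t))
      \<in> measurable ?P (count_space UNIV)"
    by (rule measurable_Least)
  have "(\<lambda>\<omega>. final_graph r n V (fst \<omega>) (snd \<omega>)) \<in> measurable ?P (count_space I)"
    unfolding final_graph_def by (rule measurable_compose_countable[OF G L])
  then have "(\<lambda>\<omega>. card (final_graph r n V (fst \<omega>) (snd \<omega>) - initial_graph n V))
      \<in> measurable ?P (count_space UNIV)"
    by (rule measurable_compose) simp
  then show ?thesis by (simp add: added_edges_def case_prod_beta')
qed

text \<open>Removes the random choice of pairs: it suffices that the property holds for hypergraphs
  in \<open>A\<close> along every sequence of pairs on which the process stops.\<close>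

lemma prob_triadic_space_ge:
  assumes V: "V \<subseteq> {1..n}" and n: "2 \<le> n"
    and P: "\<And>H s. H \<in> A \<Longrightarrow> H \<in> set_pmf (random_hypergraph r n p) \<Longrightarrow>
      \<exists>t. stuck r n H (triadic_graph r n V H s t) \<Longrightarrow> P (added_edges r n V (H, s))"
  shows "measure_pmf.prob (random_hypergraph r n p) A
    \<le> \<P>(\<omega> in triadic_space r n p. P (added_edges r n V \<omega>))"
proof -
  let ?M = "measure_pmf (random_hypergraph r n p)"
  let ?Q = "pmf_of_set (vertex_pairs n)"
  let ?N = "stream_space (measure_pmf ?Q)"
  let ?S = "set_pmf (random_hypergraph r n p)"
  interpret N: prob_space ?N by (rule prob_space.prob_space_stream_space) (rule measure_pmf.prob_space_axioms)
  interpret PP: pair_prob_space ?M ?N ..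
  have fin: "finite (vertex_pairs n)"
    by (rule finite_subset[of _ "{1..n} \<times> {1..n}"]) (auto simp: vertex_pairs_def)
  have "(1, 2) \<in> vertex_pairs n" using n by (auto simp: vertex_pairs_def)
  then have Q: "set_pmf ?Q = vertex_pairs n" using fin by (intro set_pmf_of_set) auto
  have fs: "finite {e. e \<subseteq> {1..n} \<and> card e = r}" by (rule finite_subset[of _ "Pow {1..n}"]) auto
  have supp: "H \<subseteq> Pow {1..n}" if "H \<in> ?S" for H
    using that set_Pi_pmf_subset[OF fs, of False "\<lambda>_. bernoulli_pmf p"]
    by (auto simp: random_hypergraph_def)
  have "AE s in ?N. \<forall>q\<in>vertex_pairs n. \<forall>k. \<exists>t\<ge>k. s !! t = q"
    using fin AE_stream_infinitely_often[of _ ?Q] Q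
    by (subst AE_finite_all) (auto simp: AE_all_countable)
  \<comment> \<open>Stopping follows from every pair recurring, a property of \<open>s\<close>
    alone, so a single null set serves all hypergraphs in the support.\<close>
  then have ae: "AE s in ?N. \<forall>H\<in>?S. \<exists>t. stuck r n H (triadic_graph r n V H s t)"
    by eventually_elim (intro ballI ex_stuck V supp; blast)
  then obtain N0 where N0: "N0 \<in> sets ?N" "emeasure ?N N0 = 0"
    and sub: "{s \<in> space ?N. \<not> (\<forall>H\<in>?S. \<exists>t. stuck r n H (triadic_graph r n V H s t))} \<subseteq> N0"
    by (rule AE_E)
  have null: "UNIV \<times> N0 \<in> null_sets (?M \<Otimes>\<^sub>M ?N)"
    using N0 N.emeasure_pair_measure_Times[of UNIV ?M N0] by (auto simp: null_sets_def)
  have meas: "{\<omega> \<in> space (?M \<Otimes>\<^sub>M ?N). P (added_edges r n V \<omega>)} \<in> sets (?M \<Otimes>\<^sub>M ?N)"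
    using measurable_sets[OF measurable_added_edges[OF V], of "Collect P" r "random_hypergraph r n p" ?Q]
    by (simp add: vimage_def Int_def conj_commute)
  have "measure_pmf.prob (random_hypergraph r n p) A = measure_pmf.prob (random_hypergraph r n p) (A \<inter> ?S)"
    by (rule measure_Int_set_pmf[symmetric])
  also have "\<dots> = measure (?M \<Otimes>\<^sub>M ?N) ((A \<inter> ?S) \<times> space ?N)"
    using N.emeasure_pair_measure_Times[of "A \<inter> ?S" ?M "space ?N"]
    by (simp add: measure_def N.emeasure_space_1)
  also have "\<dots> \<le> measure (?M \<Otimes>\<^sub>M ?N) {\<omega> \<in> space (?M \<Otimes>\<^sub>M ?N). P (added_edges r n V \<omega>)}"
  proof (rule PP.P.finite_measure_mono_AE[OF _ meas], rule AE_I'[OF null], rule subsetI)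
    fix \<omega> assume \<omega>: "\<omega> \<in> {x \<in> space (?M \<Otimes>\<^sub>M ?N). \<not> (x \<in> (A \<inter> ?S) \<times> space ?N \<longrightarrow>
        x \<in> {\<omega> \<in> space (?M \<Otimes>\<^sub>M ?N). P (added_edges r n V \<omega>)})}"
    obtain H s where Hs: "\<omega> = (H, s)" by fastforce
    then have "s \<in> space ?N" "H \<in> A" "H \<in> ?S" "\<not> P (added_edges r n V (H, s))" using \<omega> by auto
    then show "\<omega> \<in> UNIV \<times> N0" using P[of H s] sub Hs by blast
  qed
  finally show ?thesis by (simp add: triadic_space_def)
qed

section \<open>Exploring the hyperedges that can act\<close>

lemma card_Union_image_le:
  fixes c d :: real
  assumes "finite I" "real (card I) \<le> d" "\<And>i. i \<in> I \<Longrightarrow> real (card (F i)) \<le> c" "0 \<le> c"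
  shows "real (card (\<Union>i\<in>I. F i)) \<le> d * c"
proof -
  have "real (card (\<Union>i\<in>I. F i)) \<le> (\<Sum>i\<in>I. real (card (F i)))"
    using card_UN_le[OF assms(1), of F] by (simp flip: of_nat_sum)
  also have "\<dots> \<le> real (card I) * c" using assms(3) by (rule sum_bounded_above)
  also have "\<dots> \<le> d * c" using assms(2,4) by (rule mult_right_mono)
  finally show ?thesis .
qed

lemma card_Un_le_add:
  fixes c d :: real
  assumes "real (card A) \<le> c" "real (card B) \<le> d"
  shows "real (card (A \<union> B)) \<le> c + d"
  using card_Un_le[of A B] assms by linarith

text \<open>\<open>V\<close> is the fixed part of the initial bipartite graph; \<open>D\<close> and
  \<open>K\<close> are the caps on degrees and codegrees outside \<open>V\<close>.\<close>

locale triadic =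
  fixes r n :: nat and V :: "nat set" and D K :: real
  assumes r: "3 \<le> r" and V_subset: "V \<subseteq> {1..n}" and card_V: "card V = r - 2"
    and D: "1 \<le> D" and K: "1 \<le> K"
begin

definition hyperedges :: "nat set set" where
  "hyperedges = {e. e \<subseteq> {1..n} \<and> card e = r}"

text \<open>A hyperedge that has been found is made to join all pairs of its vertices outside \<open>V\<close>, not only
  those it could add in the process; so each hyperedge acts only once.\<close>

definition nbrs :: "nat set set \<Rightarrow> nat \<Rightarrow> nat set" where
  "nbrs T x = {y. x \<noteq> y \<and> x \<notin> V \<and> y \<notin> V \<and> (\<exists>f\<in>T. x \<in> f \<and> y \<in> f)}"

definition common_nbrs :: "nat set set \<Rightarrow> nat \<Rightarrow> nat \<Rightarrow> nat set" where
  "common_nbrs T x y = nbrs T x \<inter> nbrs T y"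

text \<open>Edges between \<open>V\<close> and its complement are present from the start, so only
  cross edges outside \<open>V\<close> are tested. A hyperedge containing \<open>V\<close> has
  exactly two further vertices and is therefore triggered vacuously.\<close>

definition triggered :: "nat set set \<Rightarrow> nat set \<Rightarrow> bool" where
  "triggered T f \<longleftrightarrow> (\<exists>a\<in>f - V. \<exists>b\<in>f - V. a \<noteq> b \<and> f - V - {a, b} \<subseteq> common_nbrs T a b)"

text \<open>The condition \<open>x \<noteq> y\<close> matters: \<open>common_nbrs T x x\<close> is
  the whole neighbourhood of \<open>x\<close>, which may be as large as \<open>D\<close>.\<close>

definition good :: "nat set set \<Rightarrow> bool" where
  "good T \<longleftrightarrow> (\<forall>x. real (card (nbrs T x)) \<le> D) \<and> (\<forall>x y. x \<noteq> y \<longrightarrow> real (card (common_nbrs T x y)) \<le> K)"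

text \<open>The exploration stops as soon as a degree or codegree is too large. This is what bounds the
  number of questions deterministically.\<close>

definition query :: "(nat set \<times> bool) list \<Rightarrow> nat set option" where
  "query h = (let F = {f \<in> hyperedges. f \<notin> asked h \<and> triggered (found h) f}
     in if good (found h) \<and> F \<noteq> {} then Some (SOME f. f \<in> F) else None)"

text \<open>Candidates for hyperedges containing \<open>S\<close> whose other vertices come from
  \<open>C\<close> or \<open>V\<close>. Overlaps of \<open>X\<close> and \<open>S\<close> are
  tolerated, since only upper bounds are wanted. For \<open>card S > r\<close> there are
  none.\<close>

definition extensions :: "nat set \<Rightarrow> nat set \<Rightarrow> nat set set" where
  "extensions S C = (\<union>) S ` {X. X \<subseteq> C \<union> V \<and> card X + card S = r}"

text \<open>A cover of the triggered hyperedges that contain \<open>x\<close> but not all of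
  \<open>V\<close>. In the first union \<open>x\<close> belongs to the pair to be joined,
  \<open>b\<close> is its partner and \<open>w\<close> a further vertex outside \<open>V\<close>; in
  the second, \<open>x\<close> is a common neighbour of the pair \<open>a\<close>,
  \<open>b\<close>.\<close>

definition at_vertex :: "nat set set \<Rightarrow> nat \<Rightarrow> nat set set" where
  "at_vertex T x =
     (\<Union>w\<in>nbrs T x. \<Union>b\<in>nbrs T w - {x}. extensions {x, b, w} (common_nbrs T x b)) \<union>
     (\<Union>a\<in>nbrs T x. \<Union>b\<in>nbrs T x - {a}. extensions {a, b, x} (common_nbrs T a b))"

text \<open>A cover of the triggered hyperedges that create a common neighbour \<open>z\<close> of
  \<open>x\<close> and \<open>y\<close> through a new edge from \<open>x\<close> to
  \<open>z\<close>. The three unions: \<open>x\<close>, \<open>z\<close> is the pair to be joined;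
  both are common neighbours of that pair \<open>a\<close>, \<open>b\<close> and \<open>z\<close> is
  already adjacent to \<open>y\<close>; \<open>x\<close> and \<open>y\<close> are both common
  neighbours of \<open>a\<close>, \<open>b\<close>.\<close>

definition at_pair :: "nat set set \<Rightarrow> nat \<Rightarrow> nat \<Rightarrow> nat set set" where
  "at_pair T x y =
     (\<Union>z\<in>nbrs T y - {x}. extensions {x, z} (common_nbrs T x z)) \<union>
     (\<Union>z\<in>nbrs T y - {x}. \<Union>a\<in>common_nbrs T x z. \<Union>b\<in>common_nbrs T x z - {a}. extensions {a, b, x, z} (common_nbrs T a b)) \<union>
     (\<Union>a\<in>common_nbrs T x y. \<Union>b\<in>common_nbrs T x y - {a}. extensions {a, b, x, y} (common_nbrs T a b))"

section \<open>Symmetry, monotonicity and finiteness\<close>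

lemma finite_V [simp]: "finite V"
  using V_subset finite_subset by blast

lemma finite_hyperedges [simp]: "finite hyperedges"
  by (rule finite_subset[of _ "Pow {1..n}"]) (auto simp: hyperedges_def)

lemma hyperedgesD: assumes "f \<in> hyperedges" shows "f \<subseteq> {1..n}" "card f = r" "finite f"
  using assms finite_subset[of f "{1..n}"] by (auto simp: hyperedges_def)

lemma base_minus:
  assumes "f \<in> hyperedges" "V \<subseteq> f"
  shows "card (f - V) = 2"
  using assms hyperedgesD[of f] card_V r by (auto simp: card_Diff_subset)

lemma nbrs_sym: "y \<in> nbrs T x \<longleftrightarrow> x \<in> nbrs T y"
  by (auto simp: nbrs_def)

lemma common_nbrs_sym: "common_nbrs T x y = common_nbrs T y x"
  by (auto simp: common_nbrs_def)

lemma nbrs_mono: "T \<subseteq> T' \<Longrightarrow> nbrs T x \<subseteq> nbrs T' x"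
  by (auto simp: nbrs_def)

lemma common_nbrs_mono: "T \<subseteq> T' \<Longrightarrow> common_nbrs T x y \<subseteq> common_nbrs T' x y"
  unfolding common_nbrs_def by (intro Int_mono nbrs_mono)

lemma nbrs_subset: "T \<subseteq> hyperedges \<Longrightarrow> nbrs T x \<subseteq> {1..n}"
  by (auto simp: nbrs_def hyperedges_def)

lemma finite_nbrs: "T \<subseteq> hyperedges \<Longrightarrow> finite (nbrs T x)"
  by (rule finite_subset[OF nbrs_subset]) auto

lemma finite_common_nbrs: "T \<subseteq> hyperedges \<Longrightarrow> finite (common_nbrs T x y)"
  by (simp add: common_nbrs_def finite_nbrs)

lemma extensions_mono: "C \<subseteq> C' \<Longrightarrow> extensions S C \<subseteq> extensions S C'"
  by (auto simp: extensions_def)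

lemma at_vertex_mono: "T \<subseteq> T' \<Longrightarrow> at_vertex T x \<subseteq> at_vertex T' x"
  unfolding at_vertex_def
  by (intro Un_mono UN_mono extensions_mono common_nbrs_mono Diff_mono nbrs_mono order_refl)

lemma at_pair_mono: "T \<subseteq> T' \<Longrightarrow> at_pair T x y \<subseteq> at_pair T' x y"
  unfolding at_pair_def
  by (intro Un_mono UN_mono extensions_mono common_nbrs_mono Diff_mono nbrs_mono order_refl)

lemma finite_extensions: "finite C \<Longrightarrow> finite (extensions S C)"
  by (auto simp: extensions_def)

lemma finite_at_vertex: "T \<subseteq> hyperedges \<Longrightarrow> finite (at_vertex T x)"
  unfolding at_vertex_def by (intro finite_UnI finite_UN_I finite_Diff finite_extensions finite_nbrs finite_common_nbrs)

lemma finite_at_pair: "T \<subseteq> hyperedges \<Longrightarrow> finite (at_pair T x y)"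
  unfolding at_pair_def by (intro finite_UnI finite_UN_I finite_Diff finite_extensions finite_nbrs finite_common_nbrs)

section \<open>Sizes of the covers, and proofs that they cover\<close>

lemma extensionsI:
  assumes "f \<in> hyperedges" "S \<subseteq> f" "f - S \<subseteq> C \<union> V"
  shows "f \<in> extensions S C"
proof -
  have "finite f" "card f = r" using hyperedgesD[OF assms(1)] by auto
  then have "card (f - S) + card S = r"
    using assms(2) by (metis card_Diff_subset card_mono finite_subset le_add_diff_inverse2)
  moreover have "f = S \<union> (f - S)" using assms(2) by auto
  ultimately show ?thesis using assms(3) unfolding extensions_def by blast
qed

text \<open>The \<open>r - s\<close> remaining vertices are chosen from \<open>C \<union> V\<close>,
  which has at most \<open>K + r\<close> elements.\<close>

lemma card_extensions:
  assumes "finite C" "real (card C) \<le> K" "card S = s"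
  shows "real (card (extensions S C)) \<le> (if s \<le> r then (K + r) ^ (r - s) else 0)"
proof (cases "s \<le> r")
  case True
  have fin: "finite (C \<union> V)" using assms(1) by simp
  have eq: "{X. X \<subseteq> C \<union> V \<and> card X + card S = r} = {X. X \<subseteq> C \<union> V \<and> card X = r - s}"
    using True assms(3) by auto
  have "card (extensions S C) \<le> card {X. X \<subseteq> C \<union> V \<and> card X = r - s}"
    unfolding extensions_def eq using fin by (intro card_image_le) auto
  also have "\<dots> = card (C \<union> V) choose (r - s)" by (rule n_subsets[OF fin])
  also have "\<dots> \<le> card (C \<union> V) ^ (r - s)"
    by (cases "r - s \<le> card (C \<union> V)") (auto simp: binomial_le_pow binomial_eq_0)
  finally have "real (card (extensions S C)) \<le> real (card (C \<union> V)) ^ (r - s)"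
    by (simp flip: of_nat_power)
  also have "\<dots> \<le> (K + r) ^ (r - s)"
    using card_Un_le[of C V] assms(2) card_V by (intro power_mono) auto
  finally show ?thesis using True by simp
next
  case False
  then show ?thesis using assms(3) by (simp add: extensions_def)
qed

text \<open>Two vertices are chosen from neighbourhoods, at a cost of \<open>D\<close> each; the
  other \<open>r - 3\<close> come from a common neighbourhood or from \<open>V\<close>.\<close>

lemma card_at_vertex:
  assumes "T \<subseteq> hyperedges" "good T"
  shows "real (card (at_vertex T x)) \<le> 2 * D\<^sup>2 * (K + r) ^ (r - 3)"
proof -
  have nbrs: "finite (nbrs T x - X)" "real (card (nbrs T x - X)) \<le> D" for x X
    using assms card_mono[of "nbrs T x" "nbrs T x - X"] finite_nbrs[OF assms(1), of x]
    by (auto simp: good_def intro: order_trans[OF of_nat_mono])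
  have nbrs0: "finite (nbrs T x)" "real (card (nbrs T x)) \<le> D" for x
    using nbrs[of x "{}"] by auto
  have ext: "real (card (extensions S (common_nbrs T a b))) \<le> (K + r) ^ (r - 3)" if "card S = 3" "a \<noteq> b" for S a b
    using card_extensions[of "common_nbrs T a b" S 3] finite_common_nbrs[OF assms(1), of a b] assms(2) r that
    by (auto simp: good_def)
  have "real (card (at_vertex T x)) \<le> D * (D * (K + r) ^ (r - 3)) + D * (D * (K + r) ^ (r - 3))"
    unfolding at_vertex_def using K D
    by (intro card_Un_le_add card_Union_image_le nbrs nbrs0 ext)
       (auto simp: nbrs_def card_insert_if)
  then show ?thesis by (simp add: power2_eq_square algebra_simps)
qed

lemma card_at_pair:
  assumes "T \<subseteq> hyperedges" "good T" "x \<noteq> y"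
  shows "real (card (at_pair T x y)) \<le> 3 * D * (K + r) ^ (r - 2)"
proof -
  have nbrs: "finite (nbrs T x - X)" "real (card (nbrs T x - X)) \<le> D" for x X
    using assms card_mono[of "nbrs T x" "nbrs T x - X"] finite_nbrs[OF assms(1), of x]
    by (auto simp: good_def intro: order_trans[OF of_nat_mono])
  have common_nbrs: "finite (common_nbrs T x y - X)" "x \<noteq> y \<Longrightarrow> real (card (common_nbrs T x y - X)) \<le> K" for x y X
    using assms card_mono[of "common_nbrs T x y" "common_nbrs T x y - X"] finite_common_nbrs[OF assms(1), of x y]
    by (auto simp: good_def intro: order_trans[OF of_nat_mono])
  have common_nbrs0: "finite (common_nbrs T x y)" "x \<noteq> y \<Longrightarrow> real (card (common_nbrs T x y)) \<le> K" for x y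
    using common_nbrs[of x y "{}"] by auto
  \<comment> \<open>For \<open>r = 3\<close> a hyperedge cannot contain four prescribed vertices.
    The value 0 avoids the truncated exponent \<open>r - 4\<close>, which would give 1.\<close>
  let ?e = "(K + r) ^ (r - 2)" and ?d = "if 4 \<le> r then (K + r) ^ (r - 4) else 0"
  have ext: "real (card (extensions S (common_nbrs T a b))) \<le> ?e" if "card S = 2" "a \<noteq> b" for S a b
    using card_extensions[of "common_nbrs T a b" S 2] common_nbrs0 r that by auto
  have ext': "real (card (extensions S (common_nbrs T a b))) \<le> ?d" if "card S = 4" "a \<noteq> b" for S a b
    using card_extensions[of "common_nbrs T a b" S 4] common_nbrs0 that by auto
  have d: "0 \<le> ?d" "0 \<le> ?e" using K by auto
  have KK: "K * (K * ?d) \<le> ?e"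
  proof (cases "4 \<le> r")
    case True
    then have "?e = (K + r) ^ (2 + (r - 4))" by (intro arg_cong2[of _ _ _ _ "(^)"]) auto
    also have "\<dots> = (K + r) * ((K + r) * (K + r) ^ (r - 4))" by (simp add: power_add power2_eq_square)
    finally show ?thesis using True K by (auto intro!: mult_mono)
  qed (use d in auto)
  have "real (card (at_pair T x y)) \<le> D * ?e + D * (K * (K * ?d)) + K * (K * ?d)"
    unfolding at_pair_def using K D d assms(3)
    by (intro card_Un_le_add card_Union_image_le nbrs common_nbrs common_nbrs0 ext ext')
       (auto simp: nbrs_def common_nbrs_def card_insert_if)
  also have "\<dots> \<le> D * ?e + D * ?e + D * ?e"
    using KK D d mult_right_mono[of 1 D ?e] by (intro add_mono mult_left_mono) auto
  finally show ?thesis by (simp add: algebra_simps)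
qed

text \<open>Since \<open>V\<close> is not contained in \<open>f\<close>, fewer than
  \<open>r - 2\<close> vertices of \<open>f\<close> lie in \<open>V\<close>, so outside
  \<open>V\<close> there is a third vertex \<open>w\<close> besides the pair \<open>a\<close>,
  \<open>b\<close>. It ties the pair to \<open>x\<close> through edges already present.\<close>

lemma at_vertexI:
  assumes f: "f \<in> hyperedges" "triggered T f" and x: "x \<in> f" "x \<notin> V" and nV: "\<not> V \<subseteq> f"
  shows "f \<in> at_vertex T x"
proof -
  obtain a b where ab: "a \<in> f - V" "b \<in> f - V" "a \<noteq> b" "f - V - {a, b} \<subseteq> common_nbrs T a b"
    using f(2) unfolding triggered_def by (elim bexE conjE) (rule that)
  have "\<exists>w. w \<in> f - V - {a, b}"
  proof (rule ccontr)
    assume "\<not> ?thesis"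
    then have "f \<subseteq> insert a (insert b (f \<inter> V))" by auto
    then have "card f \<le> card (insert a (insert b (f \<inter> V)))" by (intro card_mono) auto
    also have "\<dots> \<le> Suc (Suc (card (f \<inter> V)))"
      using ab by (simp add: card_insert_if)
    finally have "card V \<le> card (f \<inter> V)" using hyperedgesD[OF f(1)] card_V by simp
    then have "f \<inter> V = V" by (intro card_seteq) auto
    then show False using nV by auto
  qed
  then obtain w where w: "w \<in> f - V - {a, b}" by auto
  have core: "f \<in> at_vertex T u"
    if "u \<in> f - V" "v \<in> f - V" "u \<noteq> v" "f - V - {u, v} \<subseteq> common_nbrs T u v" "w \<in> f - V - {u, v}" for u v
  proof -
    have "f \<in> extensions {u, v, w} (common_nbrs T u v)" using that f by (intro extensionsI) auto
    moreover have "w \<in> nbrs T u" "v \<in> nbrs T w - {u}" using that nbrs_sym by (auto simp: common_nbrs_def)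
    ultimately show ?thesis unfolding at_vertex_def by blast
  qed
  show ?thesis
  proof (cases "x \<in> {a, b}")
    case True
    then show ?thesis using core[of a b] core[of b a] ab w by (auto simp: common_nbrs_sym insert_commute)
  next
    case False
    then have "x \<in> common_nbrs T a b" using ab x by auto
    then have "a \<in> nbrs T x" "b \<in> nbrs T x - {a}" using ab nbrs_sym by (auto simp: common_nbrs_def)
    moreover have "f \<in> extensions {a, b, x} (common_nbrs T a b)" using ab x f by (intro extensionsI) auto
    ultimately show ?thesis unfolding at_vertex_def by blast
  qed
qed

text \<open>The case distinction is by the position of the new edge from \<open>x\<close> to
  \<open>z\<close> relative to the pair \<open>a\<close>, \<open>b\<close> that triggered
  \<open>f\<close>.\<close>

lemma at_pairI:
  assumes f: "f \<in> hyperedges" "triggered T f" and "x \<noteq> y"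
    and z: "z \<in> nbrs (insert f T) x" "z \<in> nbrs (insert f T) y" "z \<notin> nbrs T x"
  shows "f \<in> at_pair T x y"
proof -
  obtain a b where ab: "a \<in> f - V" "b \<in> f - V" "a \<noteq> b" "f - V - {a, b} \<subseteq> common_nbrs T a b"
    using f(2) unfolding triggered_def by (elim bexE conjE) (rule that)
  have xz: "x \<in> f" "z \<in> f" "x \<noteq> z" "x \<notin> V" "z \<notin> V" using z by (auto simp: nbrs_def)
  have y: "y \<notin> V" "y \<noteq> z" "y \<in> f \<or> z \<in> nbrs T y" using z(2) by (auto simp: nbrs_def)
  have zx: "x \<notin> nbrs T z" using z(3) by (simp add: nbrs_sym[of x])
  have W: "c \<in> nbrs T a \<and> c \<in> nbrs T b" if "c \<in> f" "c \<notin> V" "c \<noteq> a" "c \<noteq> b" for c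
    using subsetD[OF ab(4), of c] that by (simp add: common_nbrs_def)
  \<comment> \<open>If exactly one of \<open>x\<close>, \<open>z\<close> belonged to the pair, the
    edge between them would be a cross edge of \<open>f\<close>, hence not new.\<close>
  have xz_core: "x \<in> {a, b} \<longleftrightarrow> z \<in> {a, b}"
    using W[of x] W[of z] xz z(3) zx by auto
  show ?thesis
  proof (cases "x \<in> {a, b}")
    case True
    then have core: "f - V - {x, z} \<subseteq> common_nbrs T x z" using ab xz xz_core by (auto simp: common_nbrs_sym)
    \<comment> \<open>If \<open>y\<close> lies in \<open>f\<close>, then \<open>y\<close> is joined
      to both \<open>x\<close> and \<open>z\<close> by cross edges; otherwise \<open>f\<close>
      cannot have created the edge from \<open>y\<close> to \<open>z\<close>.\<close>
    have "z \<in> nbrs T y"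
    proof (cases "y \<in> f")
      case True
      then have "y \<in> common_nbrs T x z" using core y assms(3) by auto
      then show ?thesis using nbrs_sym by (auto simp: common_nbrs_def)
    qed (use y in auto)
    moreover have "f \<in> extensions {x, z} (common_nbrs T x z)" using core f xz by (intro extensionsI) auto
    ultimately show ?thesis unfolding at_pair_def using xz by blast
  next
    case False
    then have W: "x \<in> common_nbrs T a b" "z \<in> common_nbrs T a b" using ab xz xz_core by auto
    show ?thesis
    proof (cases "z \<in> nbrs T y")
      case True
      have "a \<in> common_nbrs T x z" "b \<in> common_nbrs T x z - {a}" using W ab nbrs_sym by (auto simp: common_nbrs_def)
      moreover have "f \<in> extensions {a, b, x, z} (common_nbrs T a b)" using ab f xz by (intro extensionsI) auto
      ultimately show ?thesis unfolding at_pair_def using xz True by blast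
    next
      case nadj: False
      \<comment> \<open>The edge from \<open>y\<close> to \<open>z\<close> is new as well, so
        \<open>y\<close> lies in \<open>f\<close>; and \<open>y\<close> is not in the pair, because
        \<open>z\<close> is already adjacent to both its members.\<close>
      then have "y \<in> f" "y \<notin> {a, b}" using y W by (auto simp: common_nbrs_def)
      then have Y: "y \<in> common_nbrs T a b" using ab y by auto
      have "a \<in> common_nbrs T x y" "b \<in> common_nbrs T x y - {a}" using W Y ab nbrs_sym by (auto simp: common_nbrs_def)
      moreover have "f \<in> extensions {a, b, x, y} (common_nbrs T a b)"
        using ab f xz \<open>y \<in> f\<close> by (intro extensionsI) auto
      ultimately show ?thesis unfolding at_pair_def by blast
    qed
  qed
qed

lemma at_pair_or:
  assumes "f \<in> hyperedges" "triggered T f" "x \<noteq> y" "common_nbrs (insert f T) x y \<noteq> common_nbrs T x y"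
  shows "f \<in> at_pair T x y \<union> at_pair T y x"
proof -
  obtain z where "z \<in> common_nbrs (insert f T) x y" "z \<notin> common_nbrs T x y"
    using assms(4) common_nbrs_mono[of T "insert f T" x y] by auto
  then have z: "z \<in> nbrs (insert f T) x" "z \<in> nbrs (insert f T) y" "z \<notin> nbrs T x \<or> z \<notin> nbrs T y"
    by (auto simp: common_nbrs_def)
  then show ?thesis using at_pairI[OF assms(1,2), of x y z] at_pairI[OF assms(1,2), of y x z] assms(3)
    by auto
qed

section \<open>Deterministic bounds along an exploration\<close>

lemma query_SomeD:
  assumes "query h = Some f"
  shows "f \<in> hyperedges" "f \<notin> asked h" "triggered (found h) f" "good (found h)"
proof -
  let ?F = "{f \<in> hyperedges. f \<notin> asked h \<and> triggered (found h) f}"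
  have *: "?F \<noteq> {}" "good (found h)" "f = (SOME f. f \<in> ?F)"
    using assms by (auto simp: query_def Let_def split: if_splits)
  then have "f \<in> ?F" using someI_ex[of "\<lambda>f. f \<in> ?F"] by auto
  with * show "f \<in> hyperedges" "f \<notin> asked h" "triggered (found h) f" "good (found h)" by auto
qed

lemma query_NoneD:
  assumes "query h = None" "good (found h)" "f \<in> hyperedges" "triggered (found h) f"
  shows "f \<in> asked h"
  using assms by (auto simp: query_def Let_def split: if_splits)

lemma reachable_asked: "reachable query b h \<Longrightarrow> asked h \<subseteq> hyperedges"
  by (induction rule: reachable.induct) (auto dest: query_SomeD)

lemma reachable_found_hyperedges: "reachable query b h \<Longrightarrow> found h \<subseteq> hyperedges"
  by (rule order_trans[OF found_subset_asked reachable_asked])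

text \<open>The family \<open>C (found h)\<close> only grows, so all counted questions lie in its
  value just before the last question. At that moment the caps still held, even if the last answer
  broke them.\<close>

lemma card_tried_le:
  assumes h: "reachable query b h"
    and ty: "\<And>h f. query h = Some f \<Longrightarrow> ty h f \<Longrightarrow> f \<in> C (found h)"
    and mono: "\<And>T T'. T \<subseteq> T' \<Longrightarrow> C T \<subseteq> C T'"
    and fin: "\<And>T. T \<subseteq> hyperedges \<Longrightarrow> finite (C T)"
    and card: "\<And>T. T \<subseteq> hyperedges \<Longrightarrow> good T \<Longrightarrow> real (card (C T)) \<le> N" and "0 \<le> N"
  shows "real (card (tried ty h)) \<le> N"
proof -
  have sub: "tried ty h \<subseteq> C (found h)" if "reachable query b h" for h
    using that
  proof (induction rule: reachable.induct)
    case (2 h f)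
    then have "f \<in> C (found h)" if "ty h f" using ty that by blast
    moreover have "C (found h) \<subseteq> C (found ((f, b f) # h))" by (intro mono) auto
    ultimately show ?case using 2 by auto
  qed auto
  from h show ?thesis
  proof (cases rule: reachable.cases)
    case 1
    then show ?thesis using assms(6) by simp
  next
    case (2 h' f)
    have T: "found h' \<subseteq> hyperedges" "good (found h')"
      using reachable_found_hyperedges[OF 2(2)] query_SomeD(4)[OF 2(3)] by auto
    have "tried ty h \<subseteq> C (found h')" using sub[OF 2(2)] ty[OF 2(3)] 2(1) by auto
    then have "card (tried ty h) \<le> card (C (found h'))" by (intro card_mono fin T)
    then show ?thesis using card[OF T] by linarith
  qed
qed

lemma hits_static: "hits (\<lambda>_. P) h = {f \<in> found h. P f}"
  by (induction h) auto

lemma card_nbrs_le: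
  assumes "reachable query b h"
  shows "card (nbrs (found h) x) \<le> r * card (hits (\<lambda>_ f. x \<in> f) h)"
proof -
  let ?F = "hits (\<lambda>_ f. x \<in> f) h"
  have F: "?F = {f \<in> found h. x \<in> f}" by (rule hits_static)
  have hy: "f \<in> hyperedges" if "f \<in> ?F" for f
    using that F reachable_found_hyperedges[OF assms] by auto
  have "nbrs (found h) x \<subseteq> \<Union>?F" by (auto simp: nbrs_def F)
  then have "card (nbrs (found h) x) \<le> card (\<Union>?F)"
    using hy hyperedgesD(3) by (intro card_mono finite_Union) auto
  also have "\<dots> \<le> (\<Sum>f\<in>?F. card f)" using card_UN_le[of ?F "\<lambda>f. f"] by simp
  also have "\<dots> = r * card ?F" using hy hyperedgesD(2) by simp
  finally show ?thesis .
qed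

text \<open>A vertex that becomes a common neighbour gains an edge from \<open>f\<close>, hence lies
  in \<open>f\<close>; so each effective hyperedge adds at most \<open>r\<close> of them.\<close>

lemma card_common_nbrs_le:
  assumes "reachable query b h"
  shows "card (common_nbrs (found h) x y)
    \<le> r * card (hits (\<lambda>h f. common_nbrs (insert f (found h)) x y \<noteq> common_nbrs (found h) x y) h)"
  using assms
proof (induction rule: reachable.induct)
  case 1
  then show ?case by (simp add: common_nbrs_def nbrs_def)
next
  case (2 h f)
  let ?ty = "\<lambda>h f. common_nbrs (insert f (found h)) x y \<noteq> common_nbrs (found h) x y"
  have f: "f \<in> hyperedges" "f \<notin> asked h" using query_SomeD[OF 2(2)] by auto
  have fin: "finite (common_nbrs (found h) x y)" by (intro finite_common_nbrs reachable_found_hyperedges[OF 2(1)])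
  show ?case
  proof (cases "b f \<and> ?ty h f")
    case True
    have new: "f \<notin> hits ?ty h" using f hits_subset[of ?ty h] found_subset_asked[of h] by auto
    have "common_nbrs (insert f (found h)) x y \<subseteq> common_nbrs (found h) x y \<union> f"
      by (auto simp: common_nbrs_def nbrs_def)
    then have "card (common_nbrs (insert f (found h)) x y) \<le> card (common_nbrs (found h) x y) + card f"
      using fin hyperedgesD(3)[OF f(1)] by (meson card_Un_le card_mono finite_UnI order_trans)
    then show ?thesis using True new 2(3) hyperedgesD(2)[OF f(1)] by simp
  next
    case False
    then show ?thesis using 2(3) by auto
  qed
qed

section \<open>Hyperedges containing \<open>V\<close>, and the completed exploration\<close>

lemma card_base: "card {f \<in> hyperedges. V \<subseteq> f} = (n - (r - 2)) choose 2"
proof -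
  have "{f \<in> hyperedges. V \<subseteq> f} = (\<union>) V ` {X. X \<subseteq> {1..n} - V \<and> card X = 2}"
  proof (intro equalityI subsetI)
    fix f assume "f \<in> {f \<in> hyperedges. V \<subseteq> f}"
    then have "f = V \<union> (f - V)" "f - V \<subseteq> {1..n} - V" "card (f - V) = 2"
      using hyperedgesD(1)[of f] base_minus[of f] by auto
    then show "f \<in> (\<union>) V ` {X. X \<subseteq> {1..n} - V \<and> card X = 2}" by blast
  next
    fix f assume "f \<in> (\<union>) V ` {X. X \<subseteq> {1..n} - V \<and> card X = 2}"
    then obtain X where X: "f = V \<union> X" "X \<subseteq> {1..n} - V" "card X = 2" by auto
    then have "finite X" using finite_subset by blast
    then have "card f = card V + card X" unfolding X(1) using X by (intro card_Un_disjoint) auto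
    then show "f \<in> {f \<in> hyperedges. V \<subseteq> f}" using X V_subset card_V r by (auto simp: hyperedges_def)
  qed
  moreover have "inj_on ((\<union>) V) {X. X \<subseteq> {1..n} - V \<and> card X = 2}"
    by (auto simp: inj_on_def)
  ultimately have "card {f \<in> hyperedges. V \<subseteq> f} = card {X. X \<subseteq> {1..n} - V \<and> card X = 2}"
    by (simp add: card_image)
  also have "\<dots> = card ({1..n} - V) choose 2" by (rule n_subsets) simp
  also have "card ({1..n} - V) = n - (r - 2)"
    using V_subset card_V by (simp add: card_Diff_subset)
  finally show ?thesis .
qed

definition final :: "(nat set \<Rightarrow> bool) \<Rightarrow> (nat set \<times> bool) list" where
  "final b = expose query b (card hyperedges) []"

lemma reachable_final: "reachable query b (final b)"
  unfolding final_def by (intro reachable_expose reachable.intros)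

lemma query_final: "query (final b) = None"
  unfolding final_def by (rule expose_terminal[of hyperedges]) (auto dest: query_SomeD)

lemma found_final: "found (final b) \<subseteq> hyperedges"
  by (rule reachable_found_hyperedges[OF reachable_final])

section \<open>Tail bounds for degrees, codegrees and hyperedges not containing
  \<open>V\<close>\<close>

lemma prob_hits_final:
  assumes p: "0 \<le> p" "p \<le> 1"
    and ty: "\<And>h f. query h = Some f \<Longrightarrow> ty h f \<Longrightarrow> f \<in> C (found h)"
    and "\<And>T T'. T \<subseteq> T' \<Longrightarrow> C T \<subseteq> C T'" "\<And>T. T \<subseteq> hyperedges \<Longrightarrow> finite (C T)"
    and "\<And>T. T \<subseteq> hyperedges \<Longrightarrow> good T \<Longrightarrow> real (card (C T)) \<le> N" "0 \<le> N"
  shows "measure_pmf.prob (Pi_pmf hyperedges False (\<lambda>_. bernoulli_pmf p))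
           {b. s \<le> real (card (hits ty (final b)))} \<le> exp (p * N - s * ln 2)"
  unfolding final_def
proof (rule prob_hits_ge[OF finite_hyperedges _ p])
  show "real (card (tried ty (expose query b (card hyperedges) []))) \<le> N" for b
    by (rule card_tried_le[where C = C, OF reachable_final[unfolded final_def] assms(3-7)])
qed (auto dest: query_SomeD)

lemma card_base_at:
  assumes "x \<notin> V"
  shows "card {f \<in> hyperedges. V \<subseteq> f \<and> x \<in> f} \<le> n"
proof -
  have "{f \<in> hyperedges. V \<subseteq> f \<and> x \<in> f} \<subseteq> (\<lambda>y. {x, y} \<union> V) ` {1..n}"
  proof
    fix f assume f: "f \<in> {f \<in> hyperedges. V \<subseteq> f \<and> x \<in> f}"
    then have "card (f - V) = 2" using base_minus by blast
    then obtain u v where uv: "f - V = {u, v}" by (auto simp: card_2_iff)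
    define y where "y = (if x = u then v else u)"
    have "x \<in> {u, v}" using f assms uv by auto
    then have fV: "f - V = {x, y}" using uv by (auto simp: y_def)
    then have "f = {x, y} \<union> V" using f by auto
    moreover have "y \<in> {1..n}" using fV f hyperedgesD(1)[of f] by auto
    ultimately show "f \<in> (\<lambda>y. {x, y} \<union> V) ` {1..n}" by blast
  qed
  then have "card {f \<in> hyperedges. V \<subseteq> f \<and> x \<in> f} \<le> card ((\<lambda>y. {x, y} \<union> V) ` {1..n})"
    by (intro card_mono) auto
  also have "\<dots> \<le> card {1..n}" by (rule card_image_le) simp
  finally show ?thesis by simp
qed

text \<open>Exceeding degree \<open>D\<close> takes at least \<open>D / r\<close> found hyperedges
  at \<open>x\<close>. The questions about \<open>x\<close> concern at most \<open>n\<close>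
  hyperedges containing \<open>V\<close>, where one more vertex is free, and those in
  \<open>at_vertex\<close>.\<close>

lemma prob_large_degree:
  assumes p: "0 \<le> p" "p \<le> 1" and x: "x \<notin> V"
  shows "measure_pmf.prob (Pi_pmf hyperedges False (\<lambda>_. bernoulli_pmf p))
     {b. D < real (card (nbrs (found (final b)) x))}
   \<le> exp (p * (real n + 2 * D\<^sup>2 * (K + r) ^ (r - 3)) - D / r * ln 2)"
proof -
  let ?C = "\<lambda>T. at_vertex T x \<union> {f \<in> hyperedges. V \<subseteq> f \<and> x \<in> f}"
  have "measure_pmf.prob (Pi_pmf hyperedges False (\<lambda>_. bernoulli_pmf p))
     {b. D < real (card (nbrs (found (final b)) x))}
    \<le> measure_pmf.prob (Pi_pmf hyperedges False (\<lambda>_. bernoulli_pmf p))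
     {b. D / r \<le> real (card (hits (\<lambda>_ f. x \<in> f) (final b)))}"
  proof (intro measure_pmf.finite_measure_mono subsetI CollectI)
    fix b assume "b \<in> {b. D < real (card (nbrs (found (final b)) x))}"
    then have "D \<le> real (r * card (hits (\<lambda>_ f. x \<in> f) (final b)))"
      using card_nbrs_le[OF reachable_final, of b x]
      by (simp only: mem_Collect_eq)
    then show "D / r \<le> real (card (hits (\<lambda>_ f. x \<in> f) (final b)))"
      using r by (simp add: field_simps)
  qed simp
  also have "\<dots> \<le> exp (p * (real n + 2 * D\<^sup>2 * (K + r) ^ (r - 3)) - D / r * ln 2)"
  proof (rule prob_hits_final[OF p, where C = ?C])
    fix h f assume "query h = Some f" "x \<in> f"
    then show "f \<in> ?C (found h)" using query_SomeD[of h f] at_vertexI[of f "found h" x] x by auto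
  next
    fix T assume T: "T \<subseteq> hyperedges" "good T"
    have "real (card (?C T)) \<le> 2 * D\<^sup>2 * (K + r) ^ (r - 3) + real n"
      by (intro card_Un_le_add card_at_vertex T of_nat_mono card_base_at x)
    then show "real (card (?C T)) \<le> real n + 2 * D\<^sup>2 * (K + r) ^ (r - 3)" by simp
  next
    show "?C T \<subseteq> ?C T'" if "T \<subseteq> T'" for T T' by (intro Un_mono at_vertex_mono that order_refl)
  qed (use finite_at_vertex K in \<open>auto intro!: add_nonneg_nonneg\<close>)
  finally show ?thesis .
qed

text \<open>The constant 6 is twice the 3 of \<open>card_at_pair\<close>: the edge completing a new
  common neighbour may start at \<open>x\<close> or at \<open>y\<close>.\<close>

lemma prob_large_codegree:
  assumes p: "0 \<le> p" "p \<le> 1" and xy: "x \<noteq> y"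
  shows "measure_pmf.prob (Pi_pmf hyperedges False (\<lambda>_. bernoulli_pmf p))
     {b. K < real (card (common_nbrs (found (final b)) x y))}
   \<le> exp (p * (6 * D * (K + r) ^ (r - 2)) - K / r * ln 2)"
proof -
  let ?C = "\<lambda>T. at_pair T x y \<union> at_pair T y x"
  let ?ty = "\<lambda>h f. common_nbrs (insert f (found h)) x y \<noteq> common_nbrs (found h) x y"
  have "measure_pmf.prob (Pi_pmf hyperedges False (\<lambda>_. bernoulli_pmf p))
     {b. K < real (card (common_nbrs (found (final b)) x y))}
    \<le> measure_pmf.prob (Pi_pmf hyperedges False (\<lambda>_. bernoulli_pmf p))
     {b. K / r \<le> real (card (hits ?ty (final b)))}"
  proof (intro measure_pmf.finite_measure_mono subsetI CollectI)
    fix b assume "b \<in> {b. K < real (card (common_nbrs (found (final b)) x y))}"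
    then have "K \<le> real (r * card (hits ?ty (final b)))"
      using card_common_nbrs_le[OF reachable_final, of b x y]
      by (simp only: mem_Collect_eq)
    then show "K / r \<le> real (card (hits ?ty (final b)))"
      using r by (simp add: field_simps)
  qed simp
  also have "\<dots> \<le> exp (p * (6 * D * (K + r) ^ (r - 2)) - K / r * ln 2)"
  proof (rule prob_hits_final[OF p, where C = ?C])
    fix h f assume "query h = Some f" "?ty h f"
    then show "f \<in> ?C (found h)" using query_SomeD[of h f] at_pair_or xy by blast
  next
    fix T assume T: "T \<subseteq> hyperedges" "good T"
    have "real (card (?C T)) \<le> 3 * D * (K + r) ^ (r - 2) + 3 * D * (K + r) ^ (r - 2)"
      using xy by (intro card_Un_le_add card_at_pair T) auto
    then show "real (card (?C T)) \<le> 6 * D * (K + r) ^ (r - 2)" by simp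
  next
    show "?C T \<subseteq> ?C T'" if "T \<subseteq> T'" for T T' by (intro Un_mono at_pair_mono that)
  qed (use finite_at_pair K D in auto)
  finally show ?thesis .
qed

text \<open>A union bound over \<open>n\<close> vertices and \<open>n ^ 2\<close> pairs; a violated
  cap implies a nonempty neighbourhood, which confines the vertices to
  \<open>{1..n}\<close>.\<close>

lemma prob_not_good:
  assumes p: "0 \<le> p" "p \<le> 1"
  shows "measure_pmf.prob (Pi_pmf hyperedges False (\<lambda>_. bernoulli_pmf p)) {b. \<not> good (found (final b))}
   \<le> real n * exp (p * (real n + 2 * D\<^sup>2 * (K + r) ^ (r - 3)) - D / r * ln 2)
     + (real n)\<^sup>2 * exp (p * (6 * D * (K + r) ^ (r - 2)) - K / r * ln 2)"
    (is "_ \<le> real n * ?e1 + _ * ?e2")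
proof -
  let ?pr = "measure_pmf.prob (Pi_pmf hyperedges False (\<lambda>_. bernoulli_pmf p))"
  define B1 where "B1 x = {b. D < real (card (nbrs (found (final b)) x))}" for x
  define B2 where "B2 q = {b. K < real (card (common_nbrs (found (final b)) (fst q) (snd q)))}" for q
  let ?I1 = "{1..n} - V" and ?I2 = "{q \<in> {1..n} \<times> {1..n}. fst q \<noteq> snd q}"
  have sub: "{b. \<not> good (found (final b))} \<subseteq> (\<Union>x\<in>?I1. B1 x) \<union> (\<Union>q\<in>?I2. B2 q)"
  proof
    fix b assume "b \<in> {b. \<not> good (found (final b))}"
    then consider x where "D < real (card (nbrs (found (final b)) x))"
      | x y where "x \<noteq> y" "K < real (card (common_nbrs (found (final b)) x y))"
      by (force simp: good_def not_le)
    then show "b \<in> (\<Union>x\<in>?I1. B1 x) \<union> (\<Union>q\<in>?I2. B2 q)"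
    proof cases
      case (1 x)
      then have "nbrs (found (final b)) x \<noteq> {}" using D by auto
      then obtain y where "x \<in> nbrs (found (final b)) y" using nbrs_sym by blast
      then have "x \<in> ?I1" using nbrs_subset[OF found_final, of b y] by (auto simp: nbrs_def)
      then show ?thesis using 1 by (auto simp: B1_def)
    next
      case (2 x y)
      then have "common_nbrs (found (final b)) x y \<noteq> {}" using K by auto
      then obtain z where "x \<in> nbrs (found (final b)) z" "y \<in> nbrs (found (final b)) z"
        using nbrs_sym unfolding common_nbrs_def by blast
      then have "(x, y) \<in> ?I2" using nbrs_subset[OF found_final, of b z] 2 by auto
      moreover have "b \<in> B2 (x, y)" using 2 by (simp add: B2_def)
      ultimately show ?thesis by blast
    qed
  qed
  have "?pr {b. \<not> good (found (final b))} \<le> ?pr (\<Union>x\<in>?I1. B1 x) + ?pr (\<Union>q\<in>?I2. B2 q)"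
    by (rule order_trans[OF measure_pmf.finite_measure_mono[OF sub] measure_Un_le]) auto
  also have "\<dots> \<le> (\<Sum>x\<in>?I1. ?pr (B1 x)) + (\<Sum>q\<in>?I2. ?pr (B2 q))"
    by (intro add_mono measure_pmf.finite_measure_subadditive_finite) auto
  also have "\<dots> \<le> real (card ?I1) * ?e1 + real (card ?I2) * ?e2"
    using prob_large_degree[OF p] prob_large_codegree[OF p]
    by (intro add_mono sum_bounded_above) (auto simp: B1_def B2_def)
  also have "\<dots> \<le> real n * ?e1 + (real n)\<^sup>2 * ?e2"
  proof (intro add_mono mult_right_mono)
    show "real (card ?I1) \<le> real n" using card_mono[of "{1..n}" ?I1] by auto
    have "card ?I2 \<le> card ({1..n} \<times> {1..n})" by (rule card_mono) auto
    then show "real (card ?I2) \<le> (real n)\<^sup>2"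
      by (simp add: card_cartesian_product power2_eq_square flip: of_nat_mult)
  qed auto
  finally show ?thesis .
qed

lemma prob_many_nonbase:
  assumes p: "0 \<le> p" "p \<le> 1"
  shows "measure_pmf.prob (Pi_pmf hyperedges False (\<lambda>_. bernoulli_pmf p))
     {b. s \<le> real (card {f \<in> found (final b). \<not> V \<subseteq> f})}
   \<le> exp (p * (real n * (2 * D\<^sup>2 * (K + r) ^ (r - 3))) - s * ln 2)"
proof -
  let ?C = "\<lambda>T. \<Union>x\<in>{1..n} - V. at_vertex T x"
  have "measure_pmf.prob (Pi_pmf hyperedges False (\<lambda>_. bernoulli_pmf p))
     {b. s \<le> real (card (hits (\<lambda>_ f. \<not> V \<subseteq> f) (final b)))}
     \<le> exp (p * (real n * (2 * D\<^sup>2 * (K + r) ^ (r - 3))) - s * ln 2)"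
  proof (rule prob_hits_final[OF p, where C = ?C])
    fix h f assume f: "query h = Some f" "\<not> V \<subseteq> f"
    note q = query_SomeD[OF f(1)]
    then obtain x where "x \<in> f - V" unfolding triggered_def by blast
    then show "f \<in> ?C (found h)" using at_vertexI[OF q(1,3) _ _ f(2)] hyperedgesD(1)[OF q(1)] by auto
  next
    fix T assume T: "T \<subseteq> hyperedges" "good T"
    show "real (card (?C T)) \<le> real n * (2 * D\<^sup>2 * (K + r) ^ (r - 3))"
      using card_mono[of "{1..n}" "{1..n} - V"] K
      by (intro card_Union_image_le card_at_vertex T) auto
  next
    show "?C T \<subseteq> ?C T'" if "T \<subseteq> T'" for T T' by (intro UN_mono at_vertex_mono that order_refl)
  qed (use finite_at_vertex K in auto)
  then show ?thesis by (simp add: hits_static)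
qed

text \<open>If the caps hold at the end, the exploration can only have stopped because every
  triggered hyperedge was asked.\<close>

lemma final_triggered:
  assumes "good (found (final b))" "f \<in> hyperedges" "b f" "triggered (found (final b)) f"
  shows "f \<in> found (final b)"
  using query_NoneD[OF query_final assms(1,2,4)] reachable_found[OF reachable_final, of b] assms(3)
  by auto

end

section \<open>Comparison of the process with the exploration\<close>

lemma initial_subset_triadic_graph: "initial_graph n V \<subseteq> triadic_graph r n V H s t"
  using triadic_graph_mono[of r n V H s 0 t] by simp

context triadic
begin

text \<open>Induction over time: when a pair outside \<open>V\<close> is added, its cross edges are
  already covered by \<open>T\<close>, so the hyperedge used is triggered and thus in
  \<open>T\<close>. Pairs inside \<open>V\<close> may also be added and are listed
  separately.\<close>

lemma triadic_graph_subset: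
  assumes H: "H \<subseteq> hyperedges" and T: "\<And>f. f \<in> H \<Longrightarrow> triggered T f \<Longrightarrow> f \<in> T"
  shows "triadic_graph r n V H s t \<subseteq>
    initial_graph n V \<union> {{x, y} | x y. x \<in> V \<and> y \<in> V} \<union> {{x, y} | x y. y \<in> nbrs T x}"
    (is "_ \<subseteq> ?G")
proof (induction t)
  case (Suc t)
  let ?g = "triadic_graph r n V H s t"
  obtain x y where xy: "s !! t = (x, y)" by fastforce
  have "{x, y} \<in> ?G" if adm: "admissible r n H ?g (x, y)"
  proof -
    obtain Z where Z: "Z \<subseteq> {1..n} - {x, y}" "card Z = r - 2"
      "\<forall>z\<in>Z. {x, z} \<in> ?g \<and> {y, z} \<in> ?g" "{x, y} \<union> Z \<in> H"
      using adm unfolding admissible_def by blast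
    let ?f = "{x, y} \<union> Z"
    have f: "?f \<subseteq> {1..n}" "card ?f = r" using hyperedgesD[of ?f] subsetD[OF H Z(4)] by auto
    have "finite Z" by (rule finite_subset[of Z "{1..n}"]) (use Z(1) in auto)
    \<comment> \<open>The stream \<open>s\<close> is arbitrary here, so a repeated vertex must be
      excluded; it would leave the hyperedge with fewer than \<open>r\<close> vertices.\<close>
    have ne: "x \<noteq> y"
    proof
      assume "x = y"
      then have "card ?f \<le> Suc (card Z)" using \<open>finite Z\<close> by (simp add: card_insert_if)
      then show False using f(2) Z(2) r by simp
    qed
    show ?thesis
    proof (cases "x \<in> V \<or> y \<in> V")
      case True
      have init: "{u, v} \<in> initial_graph n V" if "u \<in> V" "v \<in> {1..n} - V" for u v
        using that unfolding initial_graph_def complete_bipartite_def by blast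
      have xn: "x \<in> {1..n}" "y \<in> {1..n}" using f(1) by simp_all
      consider "x \<in> V" "y \<in> V" | "x \<in> V" "y \<notin> V" | "y \<in> V" "x \<notin> V" using True by blast
      then show ?thesis
      proof cases
        case 1
        then show ?thesis by blast
      next
        case 2
        then show ?thesis using init[of x y] xn by simp
      next
        case 3
        then show ?thesis using init[of y x] xn by (simp add: insert_commute)
      qed
    next
      case False
      have nbrs: "z \<in> nbrs T u" if "z \<in> Z - V" "u \<in> {x, y}" for z u
      proof -
        have "{u, z} \<in> ?G" using that Z(3) Suc by auto
        moreover have "u \<notin> V" "z \<notin> V" using that False by auto
        ultimately obtain a b where "{u, z} = {a, b}" "b \<in> nbrs T a"
          unfolding initial_graph_def complete_bipartite_def by (auto simp: doubleton_eq_iff)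
        then show ?thesis using nbrs_sym[of z T u] by (auto simp: doubleton_eq_iff)
      qed
      have "triggered T ?f" unfolding triggered_def
        using False ne nbrs by (intro bexI[of _ x] bexI[of _ y] conjI) (auto simp: common_nbrs_def)
      then have "?f \<in> T" using T Z(4) by blast
      then have "y \<in> nbrs T x" using False ne by (auto simp: nbrs_def)
      then show ?thesis by blast
    qed
  qed
  then show ?case using Suc xy by (auto simp: triadic_step_def)
qed auto

text \<open>A hyperedge containing \<open>V\<close> accounts for the single edge
  \<open>f - V\<close>, any other one in \<open>T\<close> for at most \<open>r ^ 2\<close> pairs,
  and the pairs inside \<open>V\<close> for another \<open>r ^ 2\<close>.\<close>

lemma card_triadic_graph_le:
  assumes H: "H \<subseteq> hyperedges" and T: "\<And>f. f \<in> H \<Longrightarrow> triggered T f \<Longrightarrow> f \<in> T" and TH: "T \<subseteq> H"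
  shows "card (triadic_graph r n V H s t - initial_graph n V)
    \<le> card {f \<in> H. V \<subseteq> f} + r\<^sup>2 * card {f \<in> T. \<not> V \<subseteq> f} + r\<^sup>2"
proof -
  let ?pairs = "\<lambda>A::nat set. (\<lambda>(x, y). {x, y}) ` (A \<times> A)"
  let ?B = "{f \<in> H. V \<subseteq> f}" and ?N = "{f \<in> T. \<not> V \<subseteq> f}"
  have fin: "finite H" "finite T" using finite_subset[OF H] finite_subset[OF TH] by auto
  have sub: "triadic_graph r n V H s t - initial_graph n V
      \<subseteq> (\<lambda>f. f - V) ` ?B \<union> (\<Union>f\<in>?N. ?pairs f) \<union> ?pairs V"
  proof
    fix e assume "e \<in> triadic_graph r n V H s t - initial_graph n V"
    then consider x y where "e = {x, y}" "x \<in> V" "y \<in> V" | x y where "e = {x, y}" "y \<in> nbrs T x"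
      using triadic_graph_subset[OF H T, of s t] by blast
    then show "e \<in> (\<lambda>f. f - V) ` ?B \<union> (\<Union>f\<in>?N. ?pairs f) \<union> ?pairs V"
    proof cases
      case (2 x y)
      then obtain f where f: "f \<in> T" "x \<in> f - V" "y \<in> f - V" "x \<noteq> y" by (auto simp: nbrs_def)
      show ?thesis
      proof (cases "V \<subseteq> f")
        case True
        have "f \<in> H" using f TH by auto
        then have "card (f - V) = 2" using base_minus True H by auto
        then obtain u v where "f - V = {u, v}" by (auto simp: card_2_iff)
        then have "e = f - V" using f 2 by auto
        then show ?thesis using True \<open>f \<in> H\<close> by auto
      next
        case False
        then show ?thesis using f 2 by auto
      qed
    qed auto
  qed
  have pairs: "card (?pairs A) \<le> r\<^sup>2" if "finite A" "card A \<le> r" for A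
  proof -
    have "card (?pairs A) \<le> card (A \<times> A)" using that by (intro card_image_le) auto
    also have "\<dots> \<le> r\<^sup>2" using that by (simp add: card_cartesian_product power2_eq_square mult_le_mono)
    finally show ?thesis .
  qed
  have hy: "finite f \<and> card f = r" if "f \<in> T" for f using that TH H hyperedgesD by blast
  have "card (triadic_graph r n V H s t - initial_graph n V)
      \<le> card ((\<lambda>f. f - V) ` ?B \<union> (\<Union>f\<in>?N. ?pairs f) \<union> ?pairs V)"
    using fin hy by (intro card_mono sub) auto
  also have "\<dots> \<le> card ((\<lambda>f. f - V) ` ?B) + card (\<Union>f\<in>?N. ?pairs f) + card (?pairs V)"
    by (intro order_trans[OF card_Un_le] add_mono card_Un_le order_refl)
  also have "\<dots> \<le> card ?B + r\<^sup>2 * card ?N + r\<^sup>2"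
  proof (intro add_mono)
    show "card ((\<lambda>f. f - V) ` ?B) \<le> card ?B" using fin by (intro card_image_le) auto
    have "card (\<Union>f\<in>?N. ?pairs f) \<le> (\<Sum>f\<in>?N. card (?pairs f))" using fin by (intro card_UN_le) auto
    also have "\<dots> \<le> (\<Sum>f\<in>?N. r\<^sup>2)" using hy by (intro sum_mono pairs) auto
    finally show "card (\<Union>f\<in>?N. ?pairs f) \<le> r\<^sup>2 * card ?N" by (simp add: mult.commute)
    show "card (?pairs V) \<le> r\<^sup>2" using card_V by (intro pairs) auto
  qed
  finally show ?thesis .
qed

text \<open>A hyperedge containing \<open>V\<close> is always admissible with \<open>Z = V\<close>,
  so a stuck graph contains the edge \<open>f - V\<close>; distinct such hyperedges give distinct
  edges.\<close>

lemma card_stuck_ge: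
  assumes H: "H \<subseteq> hyperedges" and stuck: "stuck r n H (triadic_graph r n V H s t)"
  shows "card {f \<in> H. V \<subseteq> f} \<le> card (triadic_graph r n V H s t - initial_graph n V)"
proof (rule card_inj_on_le[of "\<lambda>f. f - V"])
  let ?g = "triadic_graph r n V H s t"
  show "inj_on (\<lambda>f. f - V) {f \<in> H. V \<subseteq> f}" by (auto simp: inj_on_def)
  have "?g \<subseteq> Pow {1..n}"
    using H hyperedgesD(1) by (intro triadic_graph_bounded V_subset) auto
  then show "finite (?g - initial_graph n V)"
    by (rule finite_Diff[OF finite_subset]) simp
  show "(\<lambda>f. f - V) ` {f \<in> H. V \<subseteq> f} \<subseteq> ?g - initial_graph n V"
  proof clarify
    fix f assume f: "f \<in> H" "V \<subseteq> f"
    then have fh: "f \<in> hyperedges" using H by auto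
    then obtain x y where xy: "f - V = {x, y}" "x \<noteq> y"
      using base_minus[OF fh f(2)] by (auto simp: card_2_iff)
    have f_eq: "{x, y} \<union> V = f" using xy f by auto
    have x: "x \<in> {1..n}" "y \<in> {1..n}" "x \<notin> V" "y \<notin> V" using xy hyperedgesD(1)[OF fh] by auto
    have "{u, z} \<in> ?g" if "z \<in> V" "u \<in> {1..n} - V" for z u
    proof -
      have "{u, z} \<in> initial_graph n V"
        using that unfolding initial_graph_def complete_bipartite_def by blast
      then show ?thesis using initial_subset_triadic_graph by blast
    qed
    then have "admissible r n H ?g (x, y)" unfolding admissible_def
      using f_eq f x V_subset card_V by (auto intro!: exI[of _ V])
    moreover have "(x, y) \<in> vertex_pairs n" using x xy by (auto simp: vertex_pairs_def)
    ultimately have "{x, y} \<in> ?g" using stuck unfolding stuck_def by blast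
    moreover have "{x, y} \<notin> initial_graph n V"
      using x by (auto simp: initial_graph_def complete_bipartite_def doubleton_eq_iff)
    ultimately show "f - V \<in> ?g - initial_graph n V" using xy by auto
  qed
qed

lemma added_edges_bounds:
  fixes b
  defines "H \<equiv> Collect b"
  assumes H: "H \<subseteq> hyperedges" and good: "good (found (final b))"
    and stuck: "\<exists>t. stuck r n H (triadic_graph r n V H s t)"
  shows "card {f \<in> H. V \<subseteq> f} \<le> added_edges r n V (H, s)"
    and "added_edges r n V (H, s)
      \<le> card {f \<in> H. V \<subseteq> f} + r\<^sup>2 * card {f \<in> found (final b). \<not> V \<subseteq> f} + r\<^sup>2"
proof -
  show "card {f \<in> H. V \<subseteq> f} \<le> added_edges r n V (H, s)"
    unfolding added_edges_def final_graph_def prod.case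
    by (intro card_stuck_ge H) (rule LeastI_ex[OF stuck])
  show "added_edges r n V (H, s)
      \<le> card {f \<in> H. V \<subseteq> f} + r\<^sup>2 * card {f \<in> found (final b). \<not> V \<subseteq> f} + r\<^sup>2"
    unfolding added_edges_def final_graph_def prod.case
  proof (rule card_triadic_graph_le[OF H])
    show "f \<in> found (final b)" if "f \<in> H" "triggered (found (final b)) f" for f
      using final_triggered[OF good, of f] that H by (auto simp: H_def)
    show "found (final b) \<subseteq> H"
      using reachable_found[OF reachable_final, of b] by (auto simp: H_def)
  qed
qed

end

section \<open>The estimate for fixed \<open>n\<close>, and the mean number of hyperedges containing
  \<open>V\<close>\<close>

context triadic
begin

text \<open>Three bad events are excluded: a broken cap, too many found hyperedges not containing
  \<open>V\<close>, and a deviation of the binomial count of those containing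
  \<open>V\<close>.\<close>

lemma prob_added_edges_close:
  fixes p d :: real
  defines "\<mu> \<equiv> 1 / 2 * real n ^ 2 * p"
  assumes p: "0 \<le> p" "p \<le> 1" and n: "2 \<le> n" and d: "0 < d" and \<mu>: "real (r\<^sup>2) \<le> d / 4 * \<mu>"
    and mean: "\<bar>p * real ((n - (r - 2)) choose 2) - \<mu>\<bar> \<le> d / 4 * \<mu>"
  shows "1 - (real n * exp (p * (real n + 2 * D\<^sup>2 * (K + r) ^ (r - 3)) - D / r * ln 2)
      + (real n)\<^sup>2 * exp (p * (6 * D * (K + r) ^ (r - 2)) - K / r * ln 2))
      - exp (p * (real n * (2 * D\<^sup>2 * (K + r) ^ (r - 3))) - d / 4 * \<mu> / r\<^sup>2 * ln 2)
      - p * real ((n - (r - 2)) choose 2) / (d / 4 * \<mu>)\<^sup>2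
    \<le> \<P>(\<omega> in triadic_space r n p. \<bar>real (added_edges r n V \<omega>) - \<mu>\<bar> \<le> d * \<mu>)"
    (is "1 - ?e1 - ?e2 - ?e3 \<le> ?R")
proof -
  let ?P = "Pi_pmf hyperedges False (\<lambda>_. bernoulli_pmf p)"
  let ?B = "{f \<in> hyperedges. V \<subseteq> f}"
  let ?s = "d / 4 * \<mu> / r\<^sup>2"
  define B1 where "B1 = {b. \<not> good (found (final b))}"
  define B2 where "B2 = {b. ?s \<le> real (card {f \<in> found (final b). \<not> V \<subseteq> f})}"
  define B3 where "B3 = {b. d / 4 * \<mu> \<le> \<bar>real (card {f \<in> ?B. b f}) - p * card ?B\<bar>}"
  have r2: "0 < real (r\<^sup>2)" using r by simp
  have dm: "0 < d / 4 * \<mu>" using \<mu> r2 by linarith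
  have rnd: "random_hypergraph r n p = map_pmf Collect ?P"
    by (simp add: random_hypergraph_def hyperedges_def)
  have "1 - ?e1 - ?e2 - ?e3 \<le> 1 - measure_pmf.prob ?P B1 - measure_pmf.prob ?P B2 - measure_pmf.prob ?P B3"
    using prob_not_good[OF p] prob_many_nonbase[OF p, of ?s]
      prob_card_deviation[OF finite_hyperedges _ p dm, of ?B] card_base
    by (simp add: B1_def B2_def B3_def)
  also have "\<dots> \<le> 1 - measure_pmf.prob ?P (B1 \<union> B2 \<union> B3)"
  proof -
    have "measure_pmf.prob ?P (B1 \<union> B2 \<union> B3) \<le> measure_pmf.prob ?P (B1 \<union> B2) + measure_pmf.prob ?P B3"
      "measure_pmf.prob ?P (B1 \<union> B2) \<le> measure_pmf.prob ?P B1 + measure_pmf.prob ?P B2"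
      by (rule measure_Un_le; simp)+
    then show ?thesis by linarith
  qed
  also have "\<dots> = measure_pmf.prob ?P (- (B1 \<union> B2 \<union> B3))"
    using measure_pmf.prob_compl[of "B1 \<union> B2 \<union> B3" ?P] by (simp add: Compl_eq_Diff_UNIV)
  also have "\<dots> = measure_pmf.prob (random_hypergraph r n p) (Collect ` (- (B1 \<union> B2 \<union> B3)))"
    unfolding rnd measure_map_pmf by (subst inj_vimage_image_eq) (auto intro: injI)
  also have "\<dots> \<le> ?R"
  proof (rule prob_triadic_space_ge[OF V_subset n, where P = "\<lambda>k. \<bar>real k - \<mu>\<bar> \<le> d * \<mu>"])
    fix H s assume "H \<in> Collect ` (- (B1 \<union> B2 \<union> B3))" and supp: "H \<in> set_pmf (random_hypergraph r n p)"
      and stuck: "\<exists>t. stuck r n H (triadic_graph r n V H s t)"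
    then obtain b where b: "H = Collect b" "b \<notin> B1" "b \<notin> B2" "b \<notin> B3" by auto
    have H: "H \<subseteq> hyperedges"
      using supp set_Pi_pmf_subset[OF finite_hyperedges, of False "\<lambda>_. bernoulli_pmf p"] by (auto simp: rnd)
    have base: "{f \<in> H. V \<subseteq> f} = {f \<in> ?B. b f}" using H b(1) by auto
    let ?N = "card {f \<in> found (final b). \<not> V \<subseteq> f}" and ?c = "card {f \<in> ?B. b f}"
    have "?c \<le> added_edges r n V (H, s)" "added_edges r n V (H, s) \<le> ?c + r\<^sup>2 * ?N + r\<^sup>2"
      using added_edges_bounds[of b s] H b(1,2) stuck base by (auto simp: B1_def)
    then have X: "real ?c \<le> added_edges r n V (H, s)"
      "real (added_edges r n V (H, s)) \<le> ?c + real (r\<^sup>2) * ?N + real (r\<^sup>2)"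
      by (simp_all only: of_nat_le_iff flip: of_nat_mult of_nat_add)
    have "real ?N < ?s" using b(3) by (simp add: B2_def not_le)
    then have N: "real (r\<^sup>2) * ?N \<le> d / 4 * \<mu>" using r2 by (simp add: field_simps)
    have c: "\<bar>real ?c - p * real ((n - (r - 2)) choose 2)\<bar> < d / 4 * \<mu>"
      using b(4) by (simp add: B3_def not_le card_base)
    \<comment> \<open>The error budget has four equal shares: edges from hyperedges not containing
      \<open>V\<close>, pairs inside \<open>V\<close>, the binomial deviation, and the difference
      between its mean and \<open>\<mu>\<close>.\<close>
    have "d * \<mu> = 4 * (d / 4 * \<mu>)" by simp
    then show "\<bar>real (added_edges r n V (H, s)) - \<mu>\<bar> \<le> d * \<mu>"
      using X N c \<mu> mean dm by linarith
  qed
  finally show ?thesis .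
qed

end

lemma choose_two_deviation:
  "\<bar>real ((n - (r - 2)) choose 2) - real n ^ 2 / 2\<bar> \<le> real (r + 1) * real n"
proof -
  define m where "m = n - (r - 2)"
  have m: "m \<le> n" "n \<le> m + r" by (auto simp: m_def)
  have "even (m * (m - 1))" by (cases "even m") auto
  then have c: "real (m choose 2) = real m * (real m - 1) / 2"
    by (cases m) (auto simp: choose_two real_of_nat_div algebra_simps)
  have "real m * (real m - 1) \<le> real n ^ 2"
    using m mult_mono[of "real m" "real n" "real m" "real n"] by (simp add: power2_eq_square algebra_simps)
  moreover have "real n ^ 2 - real m * (real m - 1) \<le> 2 * (real (r + 1) * real n)"
  proof -
    have "real n * real n - real m * real m = (real n - real m) * (real n + real m)" by (simp add: algebra_simps)
    also have "\<dots> \<le> real r * (2 * real n)" using m by (intro mult_mono) auto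
    finally show ?thesis using m by (simp add: power2_eq_square algebra_simps)
  qed
  ultimately show ?thesis unfolding m_def[symmetric] c by (simp add: abs_le_iff field_simps)
qed

section \<open>Asymptotics\<close>

theorem theorem1p1:
  fixes r :: nat and \<alpha> :: real and p :: "nat \<Rightarrow> real" and V :: "nat \<Rightarrow> nat set"
  assumes "r \<ge> 3" and "\<alpha> > 1 / 2"
    and "\<And>n. 0 \<le> p n \<and> p n \<le> 1"
    and "p \<in> o(\<lambda>n. real n powr (- 1 / 2) * ln (real n) powr (\<alpha> * (3 - real r)))"
    and "p \<in> \<omega>(\<lambda>n. real n powr (- 2))"
    and "\<And>n. n \<ge> r \<Longrightarrow> V n \<subseteq> {1..n} \<and> card (V n) = r - 2"
  shows "\<exists>\<epsilon> :: nat \<Rightarrow> real. \<epsilon> \<longlonglongrightarrow> 0 \<and>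
    (\<lambda>n. \<P>(\<omega> in triadic_space r n (p n).
        \<bar>real (added_edges r n (V n) \<omega>) - 1 / 2 * real n ^ 2 * p n\<bar>
          \<le> \<epsilon> n * (1 / 2 * real n ^ 2 * p n))) \<longlonglongrightarrow> 1"
proof (rule ex_tendsto_zero_diagonal[where g = "\<lambda>d n. \<P>(\<omega> in triadic_space r n (p n).
        \<bar>real (added_edges r n (V n) \<omega>) - 1 / 2 * real n ^ 2 * p n\<bar>
          \<le> d * (1 / 2 * real n ^ 2 * p n))"])
  fix d :: real assume d: "0 < d"
  have p: "0 \<le> p n" "p n \<le> 1" for n using assms(3) by auto
  define L where "L n = ln (real n)" for n :: nat
  \<comment> \<open>Since \<alpha> exceeds 1/2, this cap dominates every multiple of the
    logarithm.\<close>
  define K where "K n = L n powr (2 * \<alpha>)" for n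
  \<comment> \<open>Chosen so that \<open>D n / r * ln 2\<close> equals
    \<open>4 * (n * p n + L n)\<close>.\<close>
  define A where "A = 4 * real r / ln 2"
  define D where "D n = A * (real n * p n + L n)" for n
  define \<mu> where "\<mu> n = 1 / 2 * real n ^ 2 * p n" for n
  \<comment> \<open>This is \<open>K n ^ (r - 3)\<close>. The sequences \<open>a\<close> and
    \<open>b\<close> are the two error terms that arise from the summands \<open>n * p n\<close> and
    \<open>L n\<close> of \<open>D n\<close>, and \<open>C\<close> absorbs the replacement of
    \<open>K n + r\<close> by \<open>2 * K n\<close>.\<close>
  define q where "q n = L n powr (2 * \<alpha> * (real r - 3))" for n
  define a where "a n = real n * (p n)\<^sup>2 * q n" for n
  define b where "b n = (L n)\<^sup>2 * q n / real n" for n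
  define C where "C = (2::real) ^ (r - 3)"
  have A: "1 \<le> A" using assms(1) ln_2_less_1 by (simp add: A_def field_simps)
  have C: "0 < C" by (simp add: C_def)
  have L_top: "filterlim L at_top sequentially" unfolding L_def by real_asymp
  have L1: "\<forall>\<^sub>F n in sequentially. 1 \<le> L n"
    using L_top by (simp add: filterlim_at_top)
  have K_top: "filterlim K at_top sequentially" unfolding K_def L_def using assms(2) by real_asymp
  have LK: "(\<lambda>n. L n / K n) \<longlonglongrightarrow> 0" unfolding K_def L_def using assms(2) by real_asymp
  have b0: "b \<longlonglongrightarrow> 0" unfolding b_def q_def L_def by real_asymp
  \<comment> \<open>The upper bound on \<open>p\<close>, squared: the square of the comparison
    function is \<open>1 / (n * q n)\<close>.\<close>
  have a0: "a \<longlonglongrightarrow> 0"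
  proof -
    let ?g = "\<lambda>n. real n powr (- 1 / 2) * ln (real n) powr (\<alpha> * (3 - real r))"
    have "(\<lambda>n. (p n / ?g n)\<^sup>2) \<longlonglongrightarrow> 0\<^sup>2"
      by (intro tendsto_power smalloD_tendsto assms(4))
    moreover have "\<forall>\<^sub>F n in sequentially. (p n / ?g n)\<^sup>2 = a n"
      using L1 eventually_gt_at_top[of 0]
    proof eventually_elim
      case (elim n)
      have "(real n powr (- 1 / 2))\<^sup>2 = inverse (real n)"
        using elim by (subst powr_power) (auto simp: powr_minus)
      moreover have "(ln (real n) powr (\<alpha> * (3 - real r)))\<^sup>2 = inverse (q n)"
        using elim unfolding q_def L_def powr_minus[symmetric]
        by (subst powr_power) (auto simp: algebra_simps)
      ultimately have "(?g n)\<^sup>2 = inverse (real n) * inverse (q n)" by (simp only: power_mult_distrib)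
      then show ?case by (simp only: power_divide a_def) (simp add: field_simps)
    qed
    ultimately have "a \<longlonglongrightarrow> 0\<^sup>2" by (rule Lim_transform_eventually)
    then show ?thesis by simp
  qed
  have \<mu>_top: "filterlim \<mu> at_top sequentially"
  proof -
    have "filterlim (\<lambda>n. norm (p n / real n powr (- 2))) at_top sequentially"
      by (rule smallomegaD_filterlim_at_top_norm[OF assms(5)]) (use eventually_gt_at_top[of 0] in \<open>eventually_elim, simp\<close>)
    then have lim: "filterlim (\<lambda>n. 1 / 2 * norm (p n / real n powr (- 2))) at_top sequentially"
      by (intro filterlim_tendsto_pos_mult_at_top[OF tendsto_const]) auto
    have ev: "\<forall>\<^sub>F n in sequentially. 1 / 2 * norm (p n / real n powr (- 2)) = \<mu> n"
      using eventually_gt_at_top[of 0]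
      by eventually_elim (use p in \<open>simp add: \<mu>_def powr_minus powr_numeral field_simps\<close>)
    show ?thesis by (rule filterlim_cong[OF refl refl ev, THEN iffD1, OF lim])
  qed
  have q0: "0 \<le> q n" for n by (simp add: q_def)
  have KK: "\<forall>\<^sub>F n in sequentially. K n + r \<le> 2 * K n \<and> (K n + r) ^ (r - 3) \<le> C * q n"
    using L1 filterlim_at_top[THEN iffD1, OF K_top, rule_format, of "real r"]
  proof eventually_elim
    case (elim n)
    have "(K n + r) ^ (r - 3) \<le> (2 * K n) ^ (r - 3)" using elim by (intro power_mono) auto
    also have "\<dots> = C * q n" using elim assms(1)
      by (simp add: power_mult_distrib C_def K_def q_def powr_power of_nat_diff mult.commute)
    finally show ?case using elim by auto
  qed
  \<comment> \<open>The logarithmic summand of \<open>D n\<close> contributes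
    \<open>p n * L n * q n\<close>, the geometric mean of \<open>a n\<close> and
    \<open>b n\<close>.\<close>
  have small1: "\<forall>\<^sub>F n in sequentially. p n * D n * (C * q n) \<le> e" if "0 < e" for e
  proof -
    have "(\<lambda>n. A * C * (a n + sqrt (a n * b n))) \<longlonglongrightarrow> A * C * (0 + sqrt (0 * 0))"
      by (intro tendsto_intros a0 b0)
    then have "\<forall>\<^sub>F n in sequentially. A * C * (a n + sqrt (a n * b n)) < e"
      using that by (intro order_tendstoD(2)) auto
    then show ?thesis using L1 eventually_gt_at_top[of 0]
    proof eventually_elim
      case (elim n)
      have "a n * b n = (p n * L n * q n)\<^sup>2"
        using elim by (simp add: a_def b_def power2_eq_square)
      then have "sqrt (a n * b n) = p n * L n * q n"
        using elim p q0 by (simp add: real_sqrt_mult)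
      then have "p n * D n * (C * q n) = A * C * (a n + sqrt (a n * b n))"
        by (simp add: a_def D_def power2_eq_square algebra_simps)
      then show ?case using elim by linarith
    qed
  qed
  have small2: "\<forall>\<^sub>F n in sequentially. 2 * (D n)\<^sup>2 * (C * q n) \<le> e * real n" if "0 < e" for e
  proof -
    have "(\<lambda>n. 4 * A\<^sup>2 * C * (a n + b n)) \<longlonglongrightarrow> 4 * A\<^sup>2 * C * (0 + 0)"
      by (intro tendsto_intros a0 b0)
    then have "\<forall>\<^sub>F n in sequentially. 4 * A\<^sup>2 * C * (a n + b n) < e"
      using that by (intro order_tendstoD(2)) auto
    then show ?thesis using eventually_gt_at_top[of 0]
    proof eventually_elim
      case (elim n)
      have "2 * (D n)\<^sup>2 * (C * q n) = 2 * A\<^sup>2 * C * q n * (real n * p n + L n)\<^sup>2"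
        by (simp add: D_def power_mult_distrib)
      also have "\<dots> \<le> 2 * A\<^sup>2 * C * q n * (2 * ((real n * p n)\<^sup>2 + (L n)\<^sup>2))"
        using C q0 sum_squares_bound[of "real n * p n" "L n"]
        by (intro mult_left_mono) (auto simp: power2_sum)
      also have "\<dots> = 4 * A\<^sup>2 * C * (a n + b n) * real n"
        using elim by (simp add: a_def b_def field_simps power2_eq_square)
      also have "\<dots> \<le> e * real n" using elim by (intro mult_right_mono) auto
      finally show ?case .
    qed
  qed
  define c where "c = d / 8 / real (r\<^sup>2) * ln 2"
  have c: "0 < c" using d assms(1) by (simp add: c_def)
  have lnr: "0 < ln 2 / real r" using assms(1) by simp
  let ?pr = "\<lambda>n. \<P>(\<omega> in triadic_space r n (p n). \<bar>real (added_edges r n (V n) \<omega>) - \<mu> n\<bar> \<le> d * \<mu> n)"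
  let ?lower = "\<lambda>n. 1 - 2 * inverse (real n) - exp (- (c * \<mu> n)) - (1 + d / 4) / (d / 4)\<^sup>2 * inverse (\<mu> n)"
  have lower: "\<forall>\<^sub>F n in sequentially. ?lower n \<le> ?pr n"
  proof -
    have ev_mean: "\<forall>\<^sub>F n in sequentially. real (r + 1) * real n \<le> d / 8 * real n ^ 2"
      using d by real_asymp
    have ev_K: "\<forall>\<^sub>F n in sequentially. L n / K n < ln 2 / (6 * real r)"
      using LK lnr by (intro order_tendstoD(2)) auto
    have ev_\<mu>: "\<forall>\<^sub>F n in sequentially. max 1 (real (r\<^sup>2) / (d / 4)) \<le> \<mu> n"
      using \<mu>_top by (simp only: filterlim_at_top)
    have ev_K1: "\<forall>\<^sub>F n in sequentially. 1 \<le> K n"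
      using K_top by (simp only: filterlim_at_top)
    \<comment> \<open>The three thresholds serve the degree, the codegree and the count of
      hyperedges not containing \<open>V\<close>, in this order.\<close>
    have l1: "0 < ln 2 / (4 * real r)" and l2: "0 < ln 2 / (24 * real r)" and l3: "0 < c / 2" using lnr c by auto
    show ?thesis
      using small1[OF l1] small1[OF l2] small2[OF l3] KK L1 ev_mean ev_K ev_\<mu> ev_K1
        eventually_ge_at_top[of "max r 2"]
    proof eventually_elim
      case (elim n)
      let ?W = "(K n + real r) ^ (r - 3)"
      have W: "?W \<le> C * q n" "0 \<le> ?W" using elim by auto
      have np: "0 \<le> real n * p n" using p by simp
      have Dge: "1 \<le> D n" unfolding D_def
        using A elim np mult_mono[of 1 A 1 "real n * p n + L n"] by auto
      interpret triadic r n "V n" "D n" "K n"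
        using assms(1,6) elim Dge by unfold_locales auto
      have eL: "exp (- L n) = inverse (real n)" "exp (L n) = real n" using elim by (auto simp: L_def exp_minus)
      \<comment> \<open>The exponent is at most \<open>n p + 2 (n p + L) - 4 (n p + L)\<close>,
        hence at most \<open>- 2 L\<close>; one \<open>L\<close> pays for the factor
        \<open>n\<close>.\<close>
      have e1: "real n * exp (p n * (real n + 2 * (D n)\<^sup>2 * ?W) - D n / r * ln 2) \<le> inverse (real n)"
      proof -
        have "p n * D n * ?W \<le> ln 2 / (4 * real r)"
          using mult_left_mono[OF W(1), of "p n * D n"] p Dge elim by auto
        then have "D n * (p n * D n * ?W) \<le> D n * (ln 2 / (4 * real r))"
          using Dge by (intro mult_left_mono) auto
        then have "p n * (2 * (D n)\<^sup>2 * ?W) \<le> D n * (ln 2 / (2 * real r))"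
          by (simp add: power2_eq_square algebra_simps)
        moreover have "D n * (ln 2 / (2 * real r)) = 2 * (real n * p n + L n)"
          using assms(1) by (simp add: D_def A_def)
        moreover have "D n / r * ln 2 = 4 * (real n * p n + L n)"
          using assms(1) by (simp add: D_def A_def)
        ultimately have "L n + (p n * (real n + 2 * (D n)\<^sup>2 * ?W) - D n / r * ln 2) \<le> - L n"
          using np elim by (simp only: distrib_left) (simp add: mult.commute)
        then have "exp (L n + (p n * (real n + 2 * (D n)\<^sup>2 * ?W) - D n / r * ln 2)) \<le> exp (- L n)"
          by (simp only: exp_le_cancel_iff)
        then show ?thesis by (simp only: exp_add eL)
      qed
      \<comment> \<open>The positive part uses up at most half of \<open>K n / r * ln 2\<close>, and
        the other half is at least \<open>3 * L n\<close>; two of these logarithms pay for the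
        factor \<open>n ^ 2\<close>.\<close>
      have e2: "(real n)\<^sup>2 * exp (p n * (6 * D n * (K n + r) ^ (r - 2)) - K n / r * ln 2) \<le> inverse (real n)"
      proof -
        have le: "p n * D n * ?W \<le> ln 2 / (24 * real r)"
          using mult_left_mono[OF W(1), of "p n * D n"] p Dge elim by auto
        have "r - 2 = Suc (r - 3)" using assms(1) by arith
        then have "(K n + r) ^ (r - 2) = (K n + r) * ?W" by (simp only: power_Suc)
        then have "p n * (6 * D n * (K n + r) ^ (r - 2)) = 6 * ((K n + r) * (p n * D n * ?W))"
          by (simp only: mult_ac)
        moreover have "0 \<le> p n * D n * ?W" using p Dge W by (intro mult_nonneg_nonneg) auto
        then have "(K n + r) * (p n * D n * ?W) \<le> (2 * K n) * (ln 2 / (24 * real r))"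
          using elim le by (intro mult_mono) auto
        moreover have "6 * ((2 * K n) * (ln 2 / (24 * real r))) = K n / r * ln 2 / 2" by simp
        moreover have "3 * L n \<le> K n / r * ln 2 / 2" using elim by (simp add: field_simps)
        ultimately have "2 * L n + (p n * (6 * D n * (K n + r) ^ (r - 2)) - K n / r * ln 2) \<le> - L n"
          by linarith
        then have "exp (L n + L n + (p n * (6 * D n * (K n + r) ^ (r - 2)) - K n / r * ln 2)) \<le> exp (- L n)"
          by (subst exp_le_cancel_iff) simp
        then show ?thesis by (simp only: exp_add eL power2_eq_square)
      qed
      \<comment> \<open>The constant \<open>c\<close> is chosen so that the positive part is at most
        \<open>c * \<mu> n\<close> and the subtracted part is exactly twice that.\<close>
      have e3: "exp (p n * (real n * (2 * (D n)\<^sup>2 * ?W)) - d / 4 * \<mu> n / r\<^sup>2 * ln 2) \<le> exp (- (c * \<mu> n))"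
      proof -
        have "2 * (D n)\<^sup>2 * ?W \<le> c / 2 * real n"
          using mult_left_mono[OF W(1), of "2 * (D n)\<^sup>2"] elim by auto
        then have "p n * real n * (2 * (D n)\<^sup>2 * ?W) \<le> p n * real n * (c / 2 * real n)"
          using p by (intro mult_left_mono) auto
        moreover have "p n * real n * (c / 2 * real n) = c * \<mu> n" by (simp add: \<mu>_def power2_eq_square)
        moreover have "d / 4 * \<mu> n / r\<^sup>2 * ln 2 = 2 * (c * \<mu> n)" by (simp add: c_def)
        moreover have "p n * (real n * (2 * (D n)\<^sup>2 * ?W)) = p n * real n * (2 * (D n)\<^sup>2 * ?W)"
          by (rule mult.assoc[symmetric])
        ultimately have "p n * (real n * (2 * (D n)\<^sup>2 * ?W)) - d / 4 * \<mu> n / r\<^sup>2 * ln 2 \<le> - (c * \<mu> n)"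
          by linarith
        then show ?thesis by (simp only: exp_le_cancel_iff)
      qed
      have \<mu>1: "1 \<le> \<mu> n" "real (r\<^sup>2) \<le> d / 4 * \<mu> n"
        using elim d by (auto simp: field_simps)
      have mean: "\<bar>p n * real ((n - (r - 2)) choose 2) - \<mu> n\<bar> \<le> d / 4 * \<mu> n"
      proof -
        have "\<bar>real ((n - (r - 2)) choose 2) - real n ^ 2 / 2\<bar> \<le> d / 8 * real n ^ 2"
          using choose_two_deviation[of n r] elim by linarith
        then have "p n * \<bar>real ((n - (r - 2)) choose 2) - real n ^ 2 / 2\<bar> \<le> p n * (d / 8 * real n ^ 2)"
          using p by (intro mult_left_mono) auto
        then have "\<bar>p n * (real ((n - (r - 2)) choose 2) - real n ^ 2 / 2)\<bar> \<le> p n * (d / 8 * real n ^ 2)"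
          using p by (simp add: abs_mult)
        then show ?thesis by (simp add: \<mu>_def algebra_simps)
      qed
      \<comment> \<open>The mean is of order \<open>\<mu> n\<close>, so Chebyshev's bound is of
        order \<open>1 / \<mu> n\<close>.\<close>
      have e4: "p n * real ((n - (r - 2)) choose 2) / (d / 4 * \<mu> n)\<^sup>2 \<le> (1 + d / 4) / (d / 4)\<^sup>2 * inverse (\<mu> n)"
      proof -
        have "p n * real ((n - (r - 2)) choose 2) \<le> (1 + d / 4) * \<mu> n"
          using mean unfolding distrib_right by linarith
        then have "p n * real ((n - (r - 2)) choose 2) / (d / 4 * \<mu> n)\<^sup>2 \<le> (1 + d / 4) * \<mu> n / (d / 4 * \<mu> n)\<^sup>2"
          by (intro divide_right_mono) auto
        also have "\<dots> = (1 + d / 4) / (d / 4)\<^sup>2 * inverse (\<mu> n)"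
          using \<mu>1 d by (simp add: field_simps power2_eq_square)
        finally show ?thesis .
      qed
      have "2 \<le> n" using elim by simp
      from prob_added_edges_close[OF p[of n] this d \<mu>1(2)[unfolded \<mu>_def] mean[unfolded \<mu>_def]] e1 e2 e3 e4
      show ?case unfolding \<mu>_def by linarith
    qed
  qed
  have "?lower \<longlonglongrightarrow> 1 - 2 * 0 - 0 - (1 + d / 4) / (d / 4)\<^sup>2 * 0"
  proof (intro tendsto_intros)
    show "(\<lambda>n. inverse (real n)) \<longlonglongrightarrow> 0" by real_asymp
    show "(\<lambda>n. inverse (\<mu> n)) \<longlonglongrightarrow> 0"
      by (rule tendsto_inverse_0_at_top[OF \<mu>_top])
    have "filterlim (\<lambda>n. c * \<mu> n) at_top sequentially"
      by (rule filterlim_tendsto_pos_mult_at_top[OF tendsto_const c \<mu>_top])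
    then have "filterlim (\<lambda>n. - (c * \<mu> n)) at_bot sequentially" by (simp add: filterlim_uminus_at_top)
    then show "(\<lambda>n. exp (- (c * \<mu> n))) \<longlonglongrightarrow> 0" by (rule filterlim_compose[OF exp_at_bot])
  qed
  then have lim: "?lower \<longlonglongrightarrow> 1" by simp
  have "?pr n \<le> 1" for n
  proof -
    interpret S: prob_space "stream_space (measure_pmf (pmf_of_set (vertex_pairs n)))"
      by (rule prob_space.prob_space_stream_space) (rule measure_pmf.prob_space_axioms)
    interpret pair_prob_space "measure_pmf (random_hypergraph r n (p n))"
      "stream_space (measure_pmf (pmf_of_set (vertex_pairs n)))" ..
    show ?thesis unfolding triadic_space_def by (rule P.prob_le_1)
  qed
  then have "?pr \<longlonglongrightarrow> 1"
    by (intro tendsto_sandwich[OF lower _ lim tendsto_const]) auto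
  then show "(\<lambda>n. \<P>(\<omega> in triadic_space r n (p n).
        \<bar>real (added_edges r n (V n) \<omega>) - 1 / 2 * real n ^ 2 * p n\<bar>
          \<le> d * (1 / 2 * real n ^ 2 * p n))) \<longlonglongrightarrow> 1"
    by (simp only: \<mu>_def)
qed

end
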